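(* Let $\Omega\subset\mathbb{H}$ be a product domain and let $f,g\in\mathcal{SEM}(\Omega)$ be such that $f_0+g_0\equiv 1$ and $\mathcal{S}_{f,g}:\mathcal{SEM}(\Omega)\to\mathcal{SEM}(\Omega)$, $\mathcal{S}_{f,g}(\chi)=f*\chi+\chi*g$, is not an isomorphism. If $f_v^sg_v^s\not\equiv0$, then there exist invertible $h,\tilde h\in\mathcal{SEM}(\Omega)$, $\tau\in\mathcal{SEM}_{\mathbb{R}}(\Omega)\setminus\{\pm\frac12\}$ and $I\in\mathbb{S}$ such that $$h^{-*}*f_v*h=\mathcal{J}\left(\tau+\tfrac12\right)I,\qquad \tilde h*g_v*\tilde h^{-*}=\mathcal{J}\left(\tau-\tfrac12\right)I.$$ Moreover, for any $J\in\mathbb{S}$ with $I\perp J$ and $K=IJ$ we have $$\ker(\mathcal{S}_{f,g})=\left\{\alpha\, h*(\mathcal{J}J+K)*\tilde h\,:\, \alpha\in\mathcal{SEM}_{\mathbb{R}}(\Omega)\right\},$$ and, for $\mathfrak{b}\in\mathcal{SEM}(\Omega)$, the equation $\mathcal{S}_{f,g}(\chi)=\mathfrak{b}$ has a solution if and only if $\langle h^{-*}*\mathfrak{b}*\tilde h^{-*},\mathcal{J}J-K\rangle_*\equiv0$.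
   Context: $\mathbb{H}$ denotes the quaternions, $q^c$ the quaternionic conjugate, $\mathbb{S}=\{q\in\mathbb{H}: q^2=-1\}$, and $\mathbb{C}_I=\mathbb{R}+I\mathbb{R}$ for $I\in\mathbb{S}$. For $q=x+Iy$ put $\mathbb{S}_q=\{x+Jy: J\in\mathbb{S}\}$. A domain (connected open set) $\Omega\subset\mathbb{H}$ is circular if $\mathbb{S}_q\subset\Omega$ for all $q\in\Omega$; a circular domain is a product domain if $\Omega\cap\mathbb{R}=\emptyset$. A function $f$ on a circular open set $\Omega$ is slice regular ($f\in\mathcal{SR}(\Omega)$) if $f(x+Iy)=F_1(x,y)+IF_2(x,y)$ for all $x+Iy\in\Omega$ ($x,y\in\mathbb{R}$, $I\in\mathbb{S}$), with $\mathbb{H}$-valued $F_1$ even in $y$ and $F_2$ odd in $y$, and each restriction $f|_{\Omega\cap\mathbb{C}_I}$ is real differentiable with $\frac12(\partial_x+I\partial_y)f|_{\Omega\cap\mathbb{C}_I}\equiv0$. The $*$-product is $(f*g)(q)=0$ if $f(q)=0$ and $(f*g)(q)=f(q)\,g(f(q)^{-1}qf(q))$ otherwise. $f$ is slice preserving if $f(\Omega\cap\mathbb{C}_I)\subset\mathbb{C}_I$ for every $I\in\mathbb{S}$. A function $f$ is slice semi-regular on $\Omega$ ($f\in\mathcal{SEM}(\Omega)$) if there is a circular open $\widetilde\Omega\subseteq\Omega$ with $f\in\mathcal{SR}(\widetilde\Omega)$ and each point of $\Omega\setminus\widetilde\Omega$ is a pole or a removable singularity; i.e. $\Omega\setminus\widetilde\Omega$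 consists of isolated real points and isolated spheres $\mathbb{S}_p$, near each of which $\Delta_p^m f$ extends slice regularly for some integer $m\ge0$, where $\Delta_p(q)=q^2-2\mathrm{Re}(p)q+|p|^2$. Functions agreeing where both are defined are identified. $\mathcal{SEM}_{\mathbb{R}}(\Omega)$ is the subset of slice preserving elements; it is a field and the center of the algebra $(\mathcal{SEM}(\Omega),+,* )$, which is a 4-dimensional vector space over it: for an orthonormal basis $(1,I,J,K)$ of $\mathbb{H}$, each $f$ is uniquely $f_0+f_1I+f_2J+f_3K$ with $f_\ell\in\mathcal{SEM}_{\mathbb{R}}(\Omega)$. Set $f^c=f_0-(f_1I+f_2J+f_3K)$, $f^s=f*f^c=f_0^2+f_1^2+f_2^2+f_3^2$, $f_0=(f+f^c)/2$, $f_v=f-f_0$, so $f_v^s=(f_v)^s=f_1^2+f_2^2+f_3^2$, and $\langle f,g\rangle_*=(f*g^c)_0$. $f$ is $*$-invertible iff $f^s\not\equiv0$, with $f^{-*}=(f^s)^{-1}f^c$. $\mathcal{J}(q)=q_v/|q_v|$ on $\mathbb{H}\setminus\mathbb{R}$ ($q_v$ the imaginary part of $q$); it is slice preserving slice regular with $\mathcal{J}^2=-1$. Isomorphism means isomorphism of $\mathcal{SEM}_{\mathbb{R}}(\Omega)$-vector spaces. *)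

theory Defs
  imports "HOL-Analysis.Analysis"
begin

section \<open>Quaternions\<close>

datatype quat = Quat (qre: real) (qim1: real) (qim2: real) (qim3: real)

lemma quat_eq_iff:
  "p = q \<longleftrightarrow> qre p = qre q \<and> qim1 p = qim1 q \<and> qim2 p = qim2 q \<and> qim3 p = qim3 q"
  by (cases p; cases q) simp

instantiation quat :: ring_1
begin

definition zero_quat :: quat where "zero_quat = Quat 0 0 0 0"
definition one_quat :: quat where "one_quat = Quat 1 0 0 0"
definition plus_quat :: "quat \<Rightarrow> quat \<Rightarrow> quat" where
  "plus_quat p q = Quat (qre p + qre q) (qim1 p + qim1 q) (qim2 p + qim2 q) (qim3 p + qim3 q)"
definition uminus_quat :: "quat \<Rightarrow> quat" where
  "uminus_quat p = Quat (- qre p) (- qim1 p) (- qim2 p) (- qim3 p)"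
definition minus_quat :: "quat \<Rightarrow> quat \<Rightarrow> quat" where
  "minus_quat p q = Quat (qre p - qre q) (qim1 p - qim1 q) (qim2 p - qim2 q) (qim3 p - qim3 q)"
definition times_quat :: "quat \<Rightarrow> quat \<Rightarrow> quat" where
  "times_quat p q = Quat
     (qre p * qre q - qim1 p * qim1 q - qim2 p * qim2 q - qim3 p * qim3 q)
     (qre p * qim1 q + qim1 p * qre q + qim2 p * qim3 q - qim3 p * qim2 q)
     (qre p * qim2 q - qim1 p * qim3 q + qim2 p * qre q + qim3 p * qim1 q)
     (qre p * qim3 q + qim1 p * qim2 q - qim2 p * qim1 q + qim3 p * qre q)"

lemmas quat_arith_defs =
  zero_quat_def one_quat_def plus_quat_def uminus_quat_def minus_quat_def times_quat_def

instance
  by standard (simp_all add: quat_arith_defs quat_eq_iff algebra_simps)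

end

definition qcnj :: "quat \<Rightarrow> quat" where
  "qcnj q = Quat (qre q) (- qim1 q) (- qim2 q) (- qim3 q)"

instantiation quat :: real_inner
begin

definition scaleR_quat :: "real \<Rightarrow> quat \<Rightarrow> quat" where
  "scaleR_quat r q = Quat (r * qre q) (r * qim1 q) (r * qim2 q) (r * qim3 q)"
definition inner_quat :: "quat \<Rightarrow> quat \<Rightarrow> real" where
  "inner_quat p q = qre p * qre q + qim1 p * qim1 q + qim2 p * qim2 q + qim3 p * qim3 q"
definition norm_quat :: "quat \<Rightarrow> real" where
  "norm_quat q = sqrt (inner q q)"
definition sgn_quat :: "quat \<Rightarrow> quat" where
  "sgn_quat q = scaleR (inverse (norm q)) q"
definition dist_quat :: "quat \<Rightarrow> quat \<Rightarrow> real" where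
  "dist_quat p q = norm (p - q)"
definition uniformity_quat :: "(quat \<times> quat) filter" where
  "uniformity_quat = (INF e\<in>{0<..}. principal {(x, y). dist x y < e})"
definition open_quat :: "quat set \<Rightarrow> bool" where
  "open_quat U = (\<forall>x\<in>U. eventually (\<lambda>(x', y). x' = x \<longrightarrow> y \<in> U) uniformity)"

instance
proof
  fix p q r :: quat and a b :: real
  show "a *\<^sub>R (p + q) = a *\<^sub>R p + a *\<^sub>R q" "(a + b) *\<^sub>R p = a *\<^sub>R p + b *\<^sub>R p"
    "a *\<^sub>R b *\<^sub>R p = (a * b) *\<^sub>R p" "1 *\<^sub>R p = p"
    by (simp_all add: scaleR_quat_def quat_arith_defs quat_eq_iff algebra_simps)
  show "dist p q = norm (p - q)" by (rule dist_quat_def)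
  show "sgn p = inverse (norm p) *\<^sub>R p" by (rule sgn_quat_def)
  show "uniformity = (INF e\<in>{0<..}. principal {(x :: quat, y). dist x y < e})"
    by (rule uniformity_quat_def)
  show "open U \<longleftrightarrow> (\<forall>x\<in>U. \<forall>\<^sub>F (x', y) in uniformity. x' = x \<longrightarrow> y \<in> U)" for U :: "quat set"
    by (rule open_quat_def)
  show "inner p q = inner q p" "inner (p + q) r = inner p r + inner q r"
    "inner (a *\<^sub>R p) q = a * inner p q"
    by (simp_all add: inner_quat_def scaleR_quat_def plus_quat_def algebra_simps)
  show "0 \<le> inner p p" by (simp add: inner_quat_def)
  show "(inner p p = 0) = (p = 0)"
    by (auto simp: inner_quat_def zero_quat_def quat_eq_iff add_nonneg_eq_0_iff)
  show "norm p = sqrt (inner p p)" by (rule norm_quat_def)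
qed

end

instantiation quat :: real_normed_div_algebra
begin

definition inverse_quat :: "quat \<Rightarrow> quat" where
  "inverse_quat q = scaleR (inverse (inner q q)) (qcnj q)"
definition divide_quat :: "quat \<Rightarrow> quat \<Rightarrow> quat" where
  "divide_quat p q = p * inverse q"

instance
proof
  fix p q :: quat and a :: real
  have scale: "a *\<^sub>R p * q = a *\<^sub>R (p * q)" "p * a *\<^sub>R q = a *\<^sub>R (p * q)" for a and p q :: quat
    by (simp_all add: scaleR_quat_def times_quat_def quat_eq_iff algebra_simps)
  then show "a *\<^sub>R p * q = a *\<^sub>R (p * q)" "p * a *\<^sub>R q = a *\<^sub>R (p * q)" .
  have "inner (p * q) (p * q) = inner p p * inner q q"
    by (simp add: inner_quat_def times_quat_def algebra_simps)
  then show "norm (p * q) = norm p * norm q"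
    by (simp add: norm_quat_def real_sqrt_mult)
  have cnj: "p * qcnj p = inner p p *\<^sub>R 1" "qcnj p * p = inner p p *\<^sub>R 1"
    by (simp_all add: inner_quat_def scaleR_quat_def qcnj_def quat_arith_defs quat_eq_iff
        algebra_simps)
  show "p \<noteq> 0 \<Longrightarrow> inverse p * p = 1" "p \<noteq> 0 \<Longrightarrow> p * inverse p = 1"
    by (simp_all add: inverse_quat_def scale cnj)
  show "p div q = p * inverse q" by (rule divide_quat_def)
  show "inverse (0 :: quat) = 0"
    by (simp add: inverse_quat_def)
qed

end

definition qi :: quat where "qi = Quat 0 1 0 0"
definition qj :: quat where "qj = Quat 0 0 1 0"
definition qk :: quat where "qk = Quat 0 0 0 1"

definition qvec :: "quat \<Rightarrow> quat" where
  "qvec q = q - of_real (qre q)"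

definition qS :: "quat set" where
  "qS = {q. q\<^sup>2 = - 1}"

definition qslice :: "quat \<Rightarrow> quat set" where
  "qslice I = {of_real x + I * of_real y | x y. True}"

definition qsphere :: "quat \<Rightarrow> quat set" where
  "qsphere q = {p. \<exists>x y. \<exists>I\<in>qS. \<exists>J\<in>qS. q = of_real x + I * of_real y \<and> p = of_real x + J * of_real y}"

definition circular :: "quat set \<Rightarrow> bool" where
  "circular \<Omega> \<longleftrightarrow> (\<forall>q\<in>\<Omega>. qsphere q \<subseteq> \<Omega>)"

definition product_domain :: "quat set \<Rightarrow> bool" where
  "product_domain \<Omega> \<longleftrightarrow> open \<Omega> \<and> connected \<Omega> \<and> \<Omega> \<noteq> {} \<and> circular \<Omega> \<and> \<Omega> \<inter> \<real> = {}"


section \<open>Slice regular and slice semi-regular functions\<close>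

definition slice_regular :: "quat set \<Rightarrow> (quat \<Rightarrow> quat) \<Rightarrow> bool" where
  "slice_regular \<Omega> f \<longleftrightarrow>
     (\<exists>F1 F2 :: real \<Rightarrow> real \<Rightarrow> quat.
        (\<forall>x y. F1 x (- y) = F1 x y) \<and> (\<forall>x y. F2 x (- y) = - F2 x y) \<and>
        (\<forall>x y. \<forall>I\<in>qS. of_real x + I * of_real y \<in> \<Omega> \<longrightarrow>
           f (of_real x + I * of_real y) = F1 x y + I * F2 x y)) \<and>
     (\<forall>I\<in>qS. \<forall>x y. of_real x + I * of_real y \<in> \<Omega> \<longrightarrow>
        (\<exists>D. ((\<lambda>(u, v). f (of_real u + I * of_real v)) has_derivative D) (at (x, y)) \<and>
             (1/2) * (D (1, 0) + I * D (0, 1)) = 0))"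

definition slice_preserving :: "quat set \<Rightarrow> (quat \<Rightarrow> quat) \<Rightarrow> bool" where
  "slice_preserving \<Omega> f \<longleftrightarrow> (\<forall>I\<in>qS. f ` (\<Omega> \<inter> qslice I) \<subseteq> qslice I)"

definition star :: "(quat \<Rightarrow> quat) \<Rightarrow> (quat \<Rightarrow> quat) \<Rightarrow> quat \<Rightarrow> quat" (infixl \<open>\<star>\<close> 70) where
  "(f \<star> g) q = (if f q = 0 then 0 else f q * g (inverse (f q) * q * f q))"

definition qDelta :: "quat \<Rightarrow> quat \<Rightarrow> quat" where
  "qDelta p q = q\<^sup>2 - of_real (2 * qre p) * q + of_real ((norm p)\<^sup>2)"

text \<open>
  A semi-regular function on \<open>\<Omega>\<close> is represented by a total function; its values outside a
  domain of regularity \<open>W\<close> are irrelevant. Since \<open>W\<close> is circular, the pointwise formula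
  defining \<open>f \<star> g\<close> on \<open>W\<close> only involves values of \<open>f\<close> and \<open>g\<close> on \<open>W\<close>.
  If \<open>p\<close> is real then \<open>qsphere p = {p}\<close>, so isolated real points and isolated spheres are
  treated at once.
\<close>

definition regularity_domain :: "quat set \<Rightarrow> (quat \<Rightarrow> quat) \<Rightarrow> quat set \<Rightarrow> bool" where
  "regularity_domain \<Omega> f W \<longleftrightarrow>
     open W \<and> circular W \<and> W \<subseteq> \<Omega> \<and> slice_regular W f \<and>
     (\<forall>p\<in>\<Omega> - W. \<exists>U. open U \<and> circular U \<and> p \<in> U \<and> U \<subseteq> \<Omega> \<and> U - qsphere p \<subseteq> W \<and>
        (\<exists>(m::nat) g. slice_regular U g \<and> (\<forall>q\<in>U - qsphere p. g q = qDelta p q ^ m * f q)))"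

definition SEM :: "quat set \<Rightarrow> (quat \<Rightarrow> quat) set" where
  "SEM \<Omega> = {f. \<exists>W. regularity_domain \<Omega> f W}"

definition SEM_R :: "quat set \<Rightarrow> (quat \<Rightarrow> quat) set" where
  "SEM_R \<Omega> = {f. \<exists>W. regularity_domain \<Omega> f W \<and> slice_preserving W f}"

text \<open>
  Identification of semi-regular functions; every identity \<open>\<equiv>\<close> between elements
  of \<open>SEM \<Omega>\<close> refers to this relation.
\<close>

definition sem_eq :: "(quat \<Rightarrow> quat) \<Rightarrow> quat set \<Rightarrow> (quat \<Rightarrow> quat) \<Rightarrow> bool"
    (\<open>(_/ \<simeq>\<^bsub>_\<^esub> _)\<close> [51, 0, 51] 50) where
  "f \<simeq>\<^bsub>\<Omega>\<^esub> g \<longleftrightarrow> (\<exists>V W. regularity_domain \<Omega> f V \<and> regularity_domain \<Omega> g W \<and> (\<forall>q\<in>V \<inter> W. f q = g q))"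


section \<open>The algebra of semi-regular functions\<close>

text \<open>
  The coordinates \<open>f0, f1, f2, f3\<close> are unique up to \<open>\<simeq>\<close>, hence so is \<open>sem_conj \<Omega> f\<close>; the
  choice below only picks a representative. The conjugate does not depend on the
  orthonormal basis, which is fixed to be the standard one.
\<close>

definition sem_conj :: "quat set \<Rightarrow> (quat \<Rightarrow> quat) \<Rightarrow> quat \<Rightarrow> quat" where
  "sem_conj \<Omega> f = (SOME g. \<exists>f0\<in>SEM_R \<Omega>. \<exists>f1\<in>SEM_R \<Omega>. \<exists>f2\<in>SEM_R \<Omega>. \<exists>f3\<in>SEM_R \<Omega>.
     f \<simeq>\<^bsub>\<Omega>\<^esub> (\<lambda>q. f0 q + (f1 q * qi + f2 q * qj + f3 q * qk)) \<and>
     g = (\<lambda>q. f0 q - (f1 q * qi + f2 q * qj + f3 q * qk)))"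

definition sem_symm :: "quat set \<Rightarrow> (quat \<Rightarrow> quat) \<Rightarrow> quat \<Rightarrow> quat" where
  "sem_symm \<Omega> f = f \<star> sem_conj \<Omega> f"

definition sem_re :: "quat set \<Rightarrow> (quat \<Rightarrow> quat) \<Rightarrow> quat \<Rightarrow> quat" where
  "sem_re \<Omega> f = (\<lambda>q. (f q + sem_conj \<Omega> f q) / 2)"

definition sem_vec :: "quat set \<Rightarrow> (quat \<Rightarrow> quat) \<Rightarrow> quat \<Rightarrow> quat" where
  "sem_vec \<Omega> f = (\<lambda>q. f q - sem_re \<Omega> f q)"

definition sem_inner :: "quat set \<Rightarrow> (quat \<Rightarrow> quat) \<Rightarrow> (quat \<Rightarrow> quat) \<Rightarrow> quat \<Rightarrow> quat" where
  "sem_inner \<Omega> f g = sem_re \<Omega> (f \<star> sem_conj \<Omega> g)"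

definition sem_invertible :: "quat set \<Rightarrow> (quat \<Rightarrow> quat) \<Rightarrow> bool" where
  "sem_invertible \<Omega> f \<longleftrightarrow>
     f \<in> SEM \<Omega> \<and> (\<exists>g\<in>SEM \<Omega>. f \<star> g \<simeq>\<^bsub>\<Omega>\<^esub> (\<lambda>_. 1) \<and> g \<star> f \<simeq>\<^bsub>\<Omega>\<^esub> (\<lambda>_. 1))"

text \<open>The symmetrization is slice preserving, so its inverse for \<open>\<star>\<close> is the pointwise one.\<close>

definition sem_inv :: "quat set \<Rightarrow> (quat \<Rightarrow> quat) \<Rightarrow> quat \<Rightarrow> quat" where
  "sem_inv \<Omega> f = (\<lambda>q. inverse (sem_symm \<Omega> f q) * sem_conj \<Omega> f q)"

text \<open>Isomorphisms of the \<open>SEM_R \<Omega>\<close>-vector space of classes of \<open>SEM \<Omega>\<close> modulo \<open>\<simeq>\<close>.\<close>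

definition sem_isomorphism :: "quat set \<Rightarrow> ((quat \<Rightarrow> quat) \<Rightarrow> quat \<Rightarrow> quat) \<Rightarrow> bool" where
  "sem_isomorphism \<Omega> T \<longleftrightarrow>
     T \<in> SEM \<Omega> \<rightarrow> SEM \<Omega> \<and>
     (\<forall>\<phi>\<in>SEM \<Omega>. \<forall>\<psi>\<in>SEM \<Omega>. T (\<lambda>q. \<phi> q + \<psi> q) \<simeq>\<^bsub>\<Omega>\<^esub> (\<lambda>q. T \<phi> q + T \<psi> q)) \<and>
     (\<forall>\<alpha>\<in>SEM_R \<Omega>. \<forall>\<phi>\<in>SEM \<Omega>. T (\<alpha> \<star> \<phi>) \<simeq>\<^bsub>\<Omega>\<^esub> \<alpha> \<star> T \<phi>) \<and>
     (\<forall>\<phi>\<in>SEM \<Omega>. \<forall>\<psi>\<in>SEM \<Omega>. T \<phi> \<simeq>\<^bsub>\<Omega>\<^esub> T \<psi> \<longleftrightarrow> \<phi> \<simeq>\<^bsub>\<Omega>\<^esub> \<psi>) \<and>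
     (\<forall>\<psi>\<in>SEM \<Omega>. \<exists>\<phi>\<in>SEM \<Omega>. T \<phi> \<simeq>\<^bsub>\<Omega>\<^esub> \<psi>)"

definition sem_kernel :: "quat set \<Rightarrow> ((quat \<Rightarrow> quat) \<Rightarrow> quat \<Rightarrow> quat) \<Rightarrow> (quat \<Rightarrow> quat) set" where
  "sem_kernel \<Omega> T = {\<phi> \<in> SEM \<Omega>. T \<phi> \<simeq>\<^bsub>\<Omega>\<^esub> (\<lambda>_. 0)}"

definition sylvester :: "(quat \<Rightarrow> quat) \<Rightarrow> (quat \<Rightarrow> quat) \<Rightarrow> (quat \<Rightarrow> quat) \<Rightarrow> quat \<Rightarrow> quat" where
  "sylvester f g \<phi> = (\<lambda>q. (f \<star> \<phi>) q + (\<phi> \<star> g) q)"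

definition qJ :: "quat \<Rightarrow> quat" (\<open>\<J>\<close>) where
  "\<J> q = qvec q /\<^sub>R norm (qvec q)"

end

theory Submission
  imports Defs "HOL-Complex_Analysis.Meromorphic"
begin

text \<open>
  A product domain \<open>\<Omega>\<close> avoids the real axis, so every sphere \<open>S\<^sub>q\<close> in it meets the upper half of
  each slice in exactly one point, and \<open>\<Omega>\<close> is recorded by an open connected subset \<open>D\<close> of the
  upper half plane.  Put \<open>F = F\<^sub>1 + \<i> F\<^sub>2\<close> for the two halves of a slice regular function.  The
  Cauchy--Riemann equations on all slices together say that \<open>F\<close> is holomorphic with values in the
  biquaternions \<open>H \<otimes> \<complex>\<close> (\<open>stem_holomorphic\<close>, \<open>slice_regular_vimage\<close>); clearing poles with powers of
  \<open>\<Delta>\<^sub>p\<close>, semi-regular functions correspond to meromorphic \<open>F\<close> (\<open>SEM_iff\<close>), and \<open>\<simeq>\<close> is equality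
  off a subset of \<open>D\<close> without accumulation points in \<open>D\<close> (\<open>sem_eq_iff\<close>).  Under this dictionary
  \<open>\<star>\<close> is the pointwise product (\<open>biquat_eval_mult\<close>), the slice preserving functions are the scalar
  ones, and \<open>\<J>\<close> is the constant scalar \<open>\<i>\<close>.  So the theorem is about the quaternion algebra
  over the field of meromorphic functions on \<open>D\<close>, and almost all of it can be checked at a
  single point of \<open>D\<close>.  Connectedness enters only through the fact that a meromorphic function on
  \<open>D\<close> vanishes almost everywhere or almost nowhere (\<open>meromorphic_zero_or_nonzero\<close>).

  Let \<open>u, v\<close> be the vectorial parts of \<open>f, g\<close> and \<open>a = u\<^sup>s\<close>, \<open>b = v\<^sup>s\<close>, so that \<open>u\<^sup>2 = -a\<close> and
  \<open>v\<^sup>2 = -b\<close>.  Since \<open>f\<^sub>0 + g\<^sub>0 = 1\<close>, the Sylvester operator is \<open>1 + L + R\<close> with \<open>L\<close> the left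
  multiplication by \<open>u\<close> and \<open>R\<close> the right multiplication by \<open>v\<close>.  These commute, and eliminating
  first \<open>R\<close> and then \<open>L\<close> produces the scalar \<open>(1 - a + b)\<^sup>2 + 4a\<close> (\<open>sylvester_eliminate\<close>).  If it is
  not zero, the operator is invertible; hence it is zero here, and with \<open>\<tau> = (b - a)/2\<close> this
  reads \<open>a = -(\<tau> + 1/2)\<^sup>2\<close> and \<open>b = -(\<tau> - 1/2)\<^sup>2\<close>.  No square root has to be extracted, which is
  why \<open>\<tau>\<close> is a single-valued function on all of \<open>\<Omega>\<close>.

  Now \<open>u\<close> and \<open>\<J>(\<tau> + 1/2)I\<close> are vectorial with the same nonzero square, so they are conjugate:
  \<open>u c + c \<J>(\<tau> + 1/2)I\<close> intertwines them for every \<open>c\<close>, and it is invertible for \<open>c = 1\<close> or for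
  \<open>c = J\<close> (\<open>intertwiner_exists\<close>).  The same holds for \<open>v\<close>.  Since every \<open>I\<close> will do, \<open>I = i\<close> is taken
  throughout.  After conjugation the operator is explicit (\<open>sylvester_normal_form\<close>): invertible on the span of
  \<open>1, I\<close> because \<open>\<tau> \<noteq> \<plusminus>1/2\<close>, and of rank one on the span of \<open>J, K\<close>, where its kernel is spanned by
  \<open>\<J>J + K\<close> and its image is orthogonal to \<open>\<J>J - K\<close>.
\<close>

section \<open>Complex planes inside the quaternions\<close>

definition slice_emb :: "quat \<Rightarrow> complex \<Rightarrow> quat" where
  "slice_emb I w = Re w *\<^sub>R 1 + Im w *\<^sub>R I"

text \<open>
  The point of the closed upper half plane that labels the sphere \<open>S\<^sub>q\<close>.
\<close>

definition slice_coord :: "quat \<Rightarrow> complex" where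
  "slice_coord q = Complex (qre q) (norm (qvec q))"

lemma quat_sel [simp]:
  "qre 0 = 0" "qim1 0 = 0" "qim2 0 = 0" "qim3 0 = 0"
  "qre 1 = 1" "qim1 1 = 0" "qim2 1 = 0" "qim3 1 = 0"
  "qre (p + q) = qre p + qre q" "qim1 (p + q) = qim1 p + qim1 q"
  "qim2 (p + q) = qim2 p + qim2 q" "qim3 (p + q) = qim3 p + qim3 q"
  "qre (p - q) = qre p - qre q" "qim1 (p - q) = qim1 p - qim1 q"
  "qim2 (p - q) = qim2 p - qim2 q" "qim3 (p - q) = qim3 p - qim3 q"
  "qre (- p) = - qre p" "qim1 (- p) = - qim1 p" "qim2 (- p) = - qim2 p" "qim3 (- p) = - qim3 p"
  "qre (r *\<^sub>R p) = r * qre p" "qim1 (r *\<^sub>R p) = r * qim1 p"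
  "qim2 (r *\<^sub>R p) = r * qim2 p" "qim3 (r *\<^sub>R p) = r * qim3 p"
  "qre qi = 0" "qim1 qi = 1" "qim2 qi = 0" "qim3 qi = 0"
  "qre qj = 0" "qim1 qj = 0" "qim2 qj = 1" "qim3 qj = 0"
  "qre qk = 0" "qim1 qk = 0" "qim2 qk = 0" "qim3 qk = 1"
  "qre (of_real r) = r" "qim1 (of_real r) = 0" "qim2 (of_real r) = 0" "qim3 (of_real r) = 0"
  by (simp_all add: quat_arith_defs scaleR_quat_def qi_def qj_def qk_def of_real_def)

lemma quat_mult_sel:
  "qre (p * q) = qre p * qre q - qim1 p * qim1 q - qim2 p * qim2 q - qim3 p * qim3 q"
  "qim1 (p * q) = qre p * qim1 q + qim1 p * qre q + qim2 p * qim3 q - qim3 p * qim2 q"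
  "qim2 (p * q) = qre p * qim2 q - qim1 p * qim3 q + qim2 p * qre q + qim3 p * qim1 q"
  "qim3 (p * q) = qre p * qim3 q + qim1 p * qim2 q - qim2 p * qim1 q + qim3 p * qre q"
  by (simp_all add: times_quat_def)

lemma quat_unit_mult [simp]:
  "qi * qi = -1" "qj * qj = -1" "qk * qk = -1"
  "qi * qj = qk" "qj * qi = - qk" "qj * qk = qi" "qk * qj = - qi" "qk * qi = qj" "qi * qk = - qj"
  by (simp_all add: quat_eq_iff quat_mult_sel)

lemma qS_iff: "I \<in> qS \<longleftrightarrow> qre I = 0 \<and> (qim1 I)\<^sup>2 + (qim2 I)\<^sup>2 + (qim3 I)\<^sup>2 = 1"
proof
  assume "I \<in> qS"
  then have sq: "I * I = -1"
    by (simp add: qS_def power2_eq_square)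
  then have re: "(qre I)\<^sup>2 - (qim1 I)\<^sup>2 - (qim2 I)\<^sup>2 - (qim3 I)\<^sup>2 = -1"
    and im: "qre I * qim1 I = 0" "qre I * qim2 I = 0" "qre I * qim3 I = 0"
    by (auto simp: quat_eq_iff quat_mult_sel power2_eq_square)
  have "qre I = 0"
  proof (rule ccontr)
    assume "qre I \<noteq> 0"
    then have "(qre I)\<^sup>2 = -1" using re im by simp
    then show False using zero_le_power2[of "qre I"] by linarith
  qed
  with re show "qre I = 0 \<and> (qim1 I)\<^sup>2 + (qim2 I)\<^sup>2 + (qim3 I)\<^sup>2 = 1" by simp
next
  assume "qre I = 0 \<and> (qim1 I)\<^sup>2 + (qim2 I)\<^sup>2 + (qim3 I)\<^sup>2 = 1"
  then show "I \<in> qS"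
    by (auto simp: qS_def quat_eq_iff quat_mult_sel power2_eq_square algebra_simps)
qed

lemma qS_square: "I \<in> qS \<Longrightarrow> I * I = -1"
  by (simp add: qS_def power2_eq_square)

lemma qi_qS [simp]: "qi \<in> qS" and uminus_qS [simp]: "- I \<in> qS \<longleftrightarrow> I \<in> qS"
  by (simp_all add: qS_iff)

lemma norm_quat_eq: "norm q = sqrt ((qre q)\<^sup>2 + (qim1 q)\<^sup>2 + (qim2 q)\<^sup>2 + (qim3 q)\<^sup>2)"
  by (simp add: norm_quat_def inner_quat_def power2_eq_square)

lemma slice_emb_of_real_eq: "of_real x + I * of_real y = slice_emb I (Complex x y)"
  by (simp add: slice_emb_def of_real_def)

lemma slice_emb_simps [simp]:
  "slice_emb I 0 = 0" "slice_emb I 1 = 1" "slice_emb I \<i> = I"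
  "slice_emb I (v + w) = slice_emb I v + slice_emb I w"
  "slice_emb I (v - w) = slice_emb I v - slice_emb I w"
  "slice_emb I (- w) = - slice_emb I w"
  "slice_emb I (of_real r) = of_real r"
  by (simp_all add: slice_emb_def algebra_simps of_real_def)

lemma slice_emb_mult:
  assumes "I \<in> qS"
  shows "slice_emb I (v * w) = slice_emb I v * slice_emb I w"
  using qS_square[OF assms] by (simp add: slice_emb_def algebra_simps)

lemma slice_emb_commute:
  assumes "I \<in> qS"
  shows "slice_emb I v * slice_emb I w = slice_emb I w * slice_emb I v"
  by (simp add: slice_emb_mult[OF assms, symmetric] mult.commute)

lemma slice_emb_left_commute:
  assumes "I \<in> qS"
  shows "slice_emb I v * (slice_emb I w * q) = slice_emb I w * (slice_emb I v * q)"
  by (simp add: mult.assoc[symmetric] slice_emb_commute[OF assms])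

lemma slice_emb_power:
  assumes "I \<in> qS"
  shows "slice_emb I (w ^ n) = slice_emb I w ^ n"
  by (induction n) (simp_all add: slice_emb_mult[OF assms])

lemma slice_emb_inverse:
  assumes "I \<in> qS"
  shows "slice_emb I (inverse w) = inverse (slice_emb I w)"
proof (cases "w = 0")
  case False
  then have "slice_emb I w * slice_emb I (inverse w) = 1"
    by (simp add: slice_emb_mult[OF assms, symmetric])
  then show ?thesis
    by (rule inverse_unique[symmetric])
qed simp

lemma slice_emb_conjugate_unit:
  assumes "x \<noteq> 0"
  shows "inverse x * slice_emb I w * x = slice_emb (inverse x * I * x) w"
  using assms by (simp add: slice_emb_def algebra_simps)

lemma conjugate_qS:
  assumes "I \<in> qS" "x \<noteq> 0"
  shows "inverse x * I * x \<in> qS"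
proof -
  have "(inverse x * I * x) * (inverse x * I * x) = inverse x * I * (x * inverse x) * I * x"
    by (simp only: mult.assoc)
  also have "\<dots> = inverse x * (I * I) * x"
    using assms(2) by (simp add: mult.assoc)
  also have "\<dots> = -1"
    using assms by (simp add: qS_square)
  finally show ?thesis
    by (simp add: qS_def power2_eq_square)
qed

lemma slice_emb_uminus_unit: "slice_emb (- I) w = slice_emb I (cnj w)"
  by (simp add: slice_emb_def)

lemma qvec_slice_emb: "I \<in> qS \<Longrightarrow> qvec (slice_emb I w) = Im w *\<^sub>R I"
  by (simp add: quat_eq_iff qvec_def slice_emb_def qS_iff)

lemma norm_qS: "I \<in> qS \<Longrightarrow> norm I = 1"
  by (simp add: norm_quat_eq qS_iff)

lemma qre_slice_emb: "I \<in> qS \<Longrightarrow> qre (slice_emb I w) = Re w"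
  by (simp add: slice_emb_def qS_iff)

lemma slice_coord_slice_emb:
  assumes "I \<in> qS"
  shows "slice_coord (slice_emb I w) = Complex (Re w) \<bar>Im w\<bar>"
  using assms by (simp add: slice_coord_def qvec_slice_emb norm_qS qre_slice_emb)

lemma slice_coord_slice_emb_pos [simp]:
  assumes "I \<in> qS" "Im w > 0"
  shows "slice_coord (slice_emb I w) = w"
  using assms by (simp add: slice_coord_slice_emb complex_eq_iff)

lemma qJ_slice_emb [simp]:
  assumes "I \<in> qS" "Im w > 0"
  shows "\<J> (slice_emb I w) = I"
  using assms by (simp add: qJ_def qvec_slice_emb norm_qS)

lemma Im_slice_coord_pos_iff: "Im (slice_coord q) > 0 \<longleftrightarrow> q \<notin> \<real>"
proof -
  have "qvec q = 0 \<longleftrightarrow> q \<in> \<real>"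
  proof
    assume "qvec q = 0"
    then have "q = of_real (qre q)" by (simp add: qvec_def)
    then show "q \<in> \<real>" by (metis Reals_of_real)
  qed (auto simp: qvec_def Reals_def)
  then show ?thesis by (simp add: slice_coord_def)
qed

lemma qJ_qS:
  assumes "q \<notin> \<real>"
  shows "\<J> q \<in> qS"
proof -
  have nz: "norm (qvec q) > 0"
    using assms Im_slice_coord_pos_iff[of q] by (simp add: slice_coord_def)
  have "norm (\<J> q) = 1" "qre (\<J> q) = 0"
    using nz by (simp_all add: qJ_def qvec_def)
  then show ?thesis
    by (simp add: qS_iff norm_quat_eq)
qed

lemma slice_emb_qJ: "slice_emb (\<J> q) (slice_coord q) = q"
  by (cases "qvec q = 0") (auto simp: slice_emb_def slice_coord_def qJ_def qvec_def of_real_def algebra_simps)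

text \<open>Every quaternion lies in a slice; at real points any slice will do.\<close>

lemma quat_slice_emb_exhaust:
  obtains I where "I \<in> qS" "q = slice_emb I (slice_coord q)"
proof (cases "q \<in> \<real>")
  case True
  then obtain r where "q = of_real r" by (auto simp: Reals_def)
  then have "q = slice_emb qi (slice_coord q)"
    by (simp add: slice_coord_def slice_emb_def qvec_def of_real_def)
  with that[of qi] show ?thesis by simp
next
  case False
  with that show ?thesis by (metis qJ_qS slice_emb_qJ)
qed

lemma continuous_on_slice_coord: "continuous_on S slice_coord"
proof -
  have 1: "slice_coord = (\<lambda>q. Complex (inner q 1) (norm (q - of_real (inner q 1))))"
    by (simp add: fun_eq_iff slice_coord_def qvec_def inner_quat_def)
  show ?thesis
    unfolding 1 Complex_eq by (intro continuous_intros)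
qed

lemma continuous_on_slice_emb: "continuous_on S (slice_emb I)"
  unfolding slice_emb_def by (intro continuous_intros)

lemma mem_qsphere_iff: "p \<in> qsphere q \<longleftrightarrow> slice_coord p = slice_coord q"
proof
  assume "p \<in> qsphere q"
  then show "slice_coord p = slice_coord q"
    by (auto simp: qsphere_def slice_emb_of_real_eq slice_coord_slice_emb)
next
  assume eq: "slice_coord p = slice_coord q"
  obtain I where I: "I \<in> qS" "p = slice_emb I (slice_coord p)" by (rule quat_slice_emb_exhaust)
  obtain J where J: "J \<in> qS" "q = slice_emb J (slice_coord q)" by (rule quat_slice_emb_exhaust)
  have "p = of_real (Re (slice_coord q)) + I * of_real (Im (slice_coord q))"
    "q = of_real (Re (slice_coord q)) + J * of_real (Im (slice_coord q))"
    using I J eq by (simp_all add: slice_emb_of_real_eq)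
  then show "p \<in> qsphere q"
    unfolding qsphere_def using I(1) J(1) by blast
qed

lemma circular_iff: "circular W \<longleftrightarrow> (\<forall>p q. slice_coord p = slice_coord q \<longrightarrow> q \<in> W \<longrightarrow> p \<in> W)"
  unfolding circular_def subset_iff mem_qsphere_iff by blast

lemma circular_vimage_slice_coord: "circular (slice_coord -` G)"
  by (simp add: circular_iff)

lemma circular_mem_iff: "circular W \<Longrightarrow> q \<in> W \<longleftrightarrow> slice_coord q \<in> slice_coord ` W"
  unfolding circular_iff by (metis image_iff)

lemma open_vimage_slice_coord: "open G \<Longrightarrow> open (slice_coord -` G)"
  by (intro open_vimage continuous_on_slice_coord)

lemma slice_coord_image_eq:
  assumes "circular W" "W \<inter> \<real> = {}"
  shows "slice_coord ` W = {z. Im z > 0 \<and> slice_emb qi z \<in> W}"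
proof (intro set_eqI iffI)
  fix z assume z: "z \<in> slice_coord ` W"
  then have "Im z > 0" using assms(2) Im_slice_coord_pos_iff by auto
  with z show "z \<in> {z. Im z > 0 \<and> slice_emb qi z \<in> W}"
    using circular_mem_iff[OF assms(1), of "slice_emb qi z"] by simp
next
  fix z assume "z \<in> {z. Im z > 0 \<and> slice_emb qi z \<in> W}"
  then show "z \<in> slice_coord ` W"
    using slice_coord_slice_emb_pos[OF qi_qS, of z] by (metis (lifting) image_eqI mem_Collect_eq)
qed

lemma open_slice_coord_image:
  assumes "open W" "circular W" "W \<inter> \<real> = {}"
  shows "open (slice_coord ` W)"
proof -
  have "open ({z. Im z > 0} \<inter> slice_emb qi -` W)"
    using assms(1) by (intro open_Int open_halfspace_Im_gt open_vimage continuous_on_slice_emb)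
  also have "{z. Im z > 0} \<inter> slice_emb qi -` W = slice_coord ` W"
    using slice_coord_image_eq[OF assms(2,3)] by auto
  finally show ?thesis .
qed

lemma slice_emb_mem_iff:
  assumes "circular W" "I \<in> qS" "Im z > 0"
  shows "slice_emb I z \<in> W \<longleftrightarrow> z \<in> slice_coord ` W"
  using circular_mem_iff[OF assms(1), of "slice_emb I z"] assms by simp

text \<open>
  On each slice \<open>\<Delta>\<^sub>p\<close> is the real quadratic polynomial whose roots are the points of \<open>S\<^sub>p\<close> in that
  slice.  Only the root in the upper half plane matters for poles of stem functions.
\<close>

lemma qDelta_slice_emb:
  assumes "I \<in> qS"
  shows "qDelta p (slice_emb I w)
    = slice_emb I ((w - slice_coord p) * (w - cnj (slice_coord p)))"
proof -
  have n: "(norm p)\<^sup>2 = (qre p)\<^sup>2 + (norm (qvec p))\<^sup>2"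
    by (simp add: norm_quat_eq qvec_def)
  have "(w - slice_coord p) * (w - cnj (slice_coord p))
      = w * w - of_real (2 * qre p) * w + of_real ((norm p)\<^sup>2)"
    unfolding n by (simp add: slice_coord_def complex_eq_iff algebra_simps power2_eq_square)
  then show ?thesis
    by (simp add: qDelta_def slice_emb_mult[OF assms] power2_eq_square flip: of_real_mult)
qed

section \<open>Biquaternions\<close>

text \<open>
  The algebra \<open>H \<otimes> \<complex>\<close>.  Its scalar \<open>\<i>\<close> is central and is not the quaternion unit \<open>qi\<close>; the
  latter is \<open>BQ 0 1 0 0\<close>.
\<close>

datatype biquat = BQ (bq0: complex) (bq1: complex) (bq2: complex) (bq3: complex)

lemma biquat_eq_iff:
  "c = d \<longleftrightarrow> bq0 c = bq0 d \<and> bq1 c = bq1 d \<and> bq2 c = bq2 d \<and> bq3 c = bq3 d"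
  by (cases c; cases d) simp

instantiation biquat :: ring_1
begin

definition zero_biquat :: biquat where "zero_biquat = BQ 0 0 0 0"
definition one_biquat :: biquat where "one_biquat = BQ 1 0 0 0"
definition plus_biquat :: "biquat \<Rightarrow> biquat \<Rightarrow> biquat" where
  "plus_biquat c d = BQ (bq0 c + bq0 d) (bq1 c + bq1 d) (bq2 c + bq2 d) (bq3 c + bq3 d)"
definition uminus_biquat :: "biquat \<Rightarrow> biquat" where
  "uminus_biquat c = BQ (- bq0 c) (- bq1 c) (- bq2 c) (- bq3 c)"
definition minus_biquat :: "biquat \<Rightarrow> biquat \<Rightarrow> biquat" where
  "minus_biquat c d = BQ (bq0 c - bq0 d) (bq1 c - bq1 d) (bq2 c - bq2 d) (bq3 c - bq3 d)"
definition times_biquat :: "biquat \<Rightarrow> biquat \<Rightarrow> biquat" where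
  "times_biquat c d = BQ
     (bq0 c * bq0 d - bq1 c * bq1 d - bq2 c * bq2 d - bq3 c * bq3 d)
     (bq0 c * bq1 d + bq1 c * bq0 d + bq2 c * bq3 d - bq3 c * bq2 d)
     (bq0 c * bq2 d - bq1 c * bq3 d + bq2 c * bq0 d + bq3 c * bq1 d)
     (bq0 c * bq3 d + bq1 c * bq2 d - bq2 c * bq1 d + bq3 c * bq0 d)"

instance
  by standard
    (simp_all add: zero_biquat_def one_biquat_def plus_biquat_def uminus_biquat_def
      minus_biquat_def times_biquat_def biquat_eq_iff algebra_simps)

end

definition bscal :: "complex \<Rightarrow> biquat" where "bscal w = BQ w 0 0 0"
definition bconj :: "biquat \<Rightarrow> biquat" where "bconj c = BQ (bq0 c) (- bq1 c) (- bq2 c) (- bq3 c)"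
definition bvec :: "biquat \<Rightarrow> biquat" where "bvec c = BQ 0 (bq1 c) (bq2 c) (bq3 c)"
definition bdot :: "biquat \<Rightarrow> biquat \<Rightarrow> complex" where
  "bdot c d = bq0 c * bq0 d + bq1 c * bq1 d + bq2 c * bq2 d + bq3 c * bq3 d"
abbreviation bnorm :: "biquat \<Rightarrow> complex" where "bnorm c \<equiv> bdot c c"
definition bq_of_quat :: "quat \<Rightarrow> biquat" where
  "bq_of_quat q = BQ (of_real (qre q)) (of_real (qim1 q)) (of_real (qim2 q)) (of_real (qim3 q))"

lemma biquat_sel [simp]:
  "bq0 0 = 0" "bq1 0 = 0" "bq2 0 = 0" "bq3 0 = 0"
  "bq0 1 = 1" "bq1 1 = 0" "bq2 1 = 0" "bq3 1 = 0"
  "bq0 (c + d) = bq0 c + bq0 d" "bq1 (c + d) = bq1 c + bq1 d"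
  "bq2 (c + d) = bq2 c + bq2 d" "bq3 (c + d) = bq3 c + bq3 d"
  "bq0 (c - d) = bq0 c - bq0 d" "bq1 (c - d) = bq1 c - bq1 d"
  "bq2 (c - d) = bq2 c - bq2 d" "bq3 (c - d) = bq3 c - bq3 d"
  "bq0 (- c) = - bq0 c" "bq1 (- c) = - bq1 c" "bq2 (- c) = - bq2 c" "bq3 (- c) = - bq3 c"
  "bq0 (bscal w) = w" "bq1 (bscal w) = 0" "bq2 (bscal w) = 0" "bq3 (bscal w) = 0"
  "bq0 (bconj c) = bq0 c" "bq1 (bconj c) = - bq1 c" "bq2 (bconj c) = - bq2 c"
  "bq3 (bconj c) = - bq3 c"
  "bq0 (bvec c) = 0" "bq1 (bvec c) = bq1 c" "bq2 (bvec c) = bq2 c" "bq3 (bvec c) = bq3 c"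
  "bq0 (bq_of_quat q) = of_real (qre q)" "bq1 (bq_of_quat q) = of_real (qim1 q)"
  "bq2 (bq_of_quat q) = of_real (qim2 q)" "bq3 (bq_of_quat q) = of_real (qim3 q)"
  by (simp_all add: zero_biquat_def one_biquat_def plus_biquat_def uminus_biquat_def
      minus_biquat_def bscal_def bconj_def bvec_def bq_of_quat_def)

lemma biquat_mult_sel:
  "bq0 (c * d) = bq0 c * bq0 d - bq1 c * bq1 d - bq2 c * bq2 d - bq3 c * bq3 d"
  "bq1 (c * d) = bq0 c * bq1 d + bq1 c * bq0 d + bq2 c * bq3 d - bq3 c * bq2 d"
  "bq2 (c * d) = bq0 c * bq2 d - bq1 c * bq3 d + bq2 c * bq0 d + bq3 c * bq1 d"
  "bq3 (c * d) = bq0 c * bq3 d + bq1 c * bq2 d - bq2 c * bq1 d + bq3 c * bq0 d"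
  by (simp_all add: times_biquat_def)

lemma bscal_simps:
  "bscal (v + w) = bscal v + bscal w" "bscal (v - w) = bscal v - bscal w"
  "bscal (- w) = - bscal w" "bscal (v * w) = bscal v * bscal w" "bscal 1 = 1" "bscal 0 = 0"
  by (simp_all add: biquat_eq_iff biquat_mult_sel)

lemma bscal_commute: "c * bscal w = bscal w * c"
  by (simp add: biquat_eq_iff biquat_mult_sel mult.commute)

lemma biquat_mult_bconj: "c * bconj c = bscal (bnorm c)" "bconj c * c = bscal (bnorm c)"
  by (simp_all add: biquat_eq_iff biquat_mult_sel bdot_def algebra_simps)

text \<open>
  At zero divisors the value is \<open>0\<close>, because \<open>inverse 0 = 0\<close>; this is also what the pointwise
  formula for the \<open>\<star>\<close>-inverse gives at the zeros of the symmetrization.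
\<close>

definition binv :: "biquat \<Rightarrow> biquat" where
  "binv c = bscal (inverse (bnorm c)) * bconj c"

text \<open>
  Substituting the unit \<open>I\<close> for the central scalar \<open>\<i>\<close>, with scalars written to the left of \<open>qi, qj, qk\<close>.
  The map is linear but in general not multiplicative.
\<close>

definition biquat_eval :: "quat \<Rightarrow> biquat \<Rightarrow> quat" where
  "biquat_eval I c = slice_emb I (bq0 c) + slice_emb I (bq1 c) * qi + slice_emb I (bq2 c) * qj
     + slice_emb I (bq3 c) * qk"

lemma biquat_eval_simps:
  "biquat_eval I 0 = 0" "biquat_eval I 1 = 1"
  "biquat_eval I (c + d) = biquat_eval I c + biquat_eval I d"
  "biquat_eval I (c - d) = biquat_eval I c - biquat_eval I d"
  "biquat_eval I (- c) = - biquat_eval I c"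
  "biquat_eval I (bscal w) = slice_emb I w"
  by (simp_all add: biquat_eval_def algebra_simps)

lemma biquat_eval_bq_of_quat: "biquat_eval I (bq_of_quat q) = q"
  by (simp add: biquat_eval_def quat_eq_iff quat_mult_sel)

lemma biquat_eval_scal_mult:
  assumes "I \<in> qS"
  shows "biquat_eval I (bscal w * c) = slice_emb I w * biquat_eval I c"
  by (simp add: biquat_eval_def biquat_mult_sel slice_emb_mult[OF assms] algebra_simps)

lemma biquat_eval_mult_quat: "biquat_eval I (c * bq_of_quat q) = biquat_eval I c * q"
  by (simp add: biquat_eval_def slice_emb_def biquat_mult_sel quat_eq_iff quat_mult_sel algebra_simps)

text \<open>
  Conjugation by \<open>X\<close> moves the slice of \<open>I\<close> to the slice of \<open>X\<^sup>-\<^sup>1 I X\<close>, so the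
  twisted argument in the \<open>\<star>\<close>-product makes the scalars of the second factor commute past the
  first factor.  This turns \<open>\<star>\<close> into the product of biquaternions.
\<close>

lemma biquat_eval_mult:
  assumes I: "I \<in> qS"
    and X_def: "X = biquat_eval I c"
  shows "biquat_eval I (c * d)
    = (if X = 0 then 0 else X * biquat_eval (inverse X * I * X) d)"
proof -
  have expand: "biquat_eval I (c * d) = slice_emb I (bq0 d) * X + slice_emb I (bq1 d) * X * qi
      + slice_emb I (bq2 d) * X * qj + slice_emb I (bq3 d) * X * qk"
    unfolding X_def biquat_eval_def
    by (simp add: biquat_mult_sel slice_emb_mult[OF I] algebra_simps
        slice_emb_commute[OF I] slice_emb_left_commute[OF I])
  show ?thesis
  proof (cases "X = 0")
    case False
    have "X * slice_emb (inverse X * I * X) w = slice_emb I w * X" for w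
      using False by (simp add: slice_emb_conjugate_unit[OF False, symmetric] mult.assoc[symmetric])
    then have "X * biquat_eval (inverse X * I * X) d = biquat_eval I (c * d)"
      unfolding expand by (simp add: biquat_eval_def distrib_left mult.assoc[symmetric])
    with False show ?thesis by simp
  qed (simp add: expand)
qed

text \<open>
  Writing \<open>c = A + \<i> B\<close> with real quaternions \<open>A, B\<close>, the values \<open>A + qi B\<close> and \<open>A - qi B\<close> determine
  both.
\<close>

lemma biquat_eval_inject:
  assumes "\<And>I. I \<in> qS \<Longrightarrow> biquat_eval I c = biquat_eval I d"
  shows "c = d"
  using assms[of qi] assms[of "- qi"]
  by (simp add: biquat_eval_def slice_emb_def quat_eq_iff quat_mult_sel biquat_eq_iff complex_eq_iff)

section \<open>Slice regular functions and holomorphic stem functions\<close>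

text \<open>
  Quantifying over the four coordinates lets holomorphy and meromorphy be borrowed from
  complex-valued functions.
\<close>

definition bq_coords :: "(biquat \<Rightarrow> complex) set" where
  "bq_coords = {bq0, bq1, bq2, bq3}"

text \<open>
  The two halves \<open>F\<^sub>1, F\<^sub>2\<close> recovered from the values on the slice of \<open>qi\<close>.
  The formula makes sense for any \<open>f\<close>, so a representative of the stem function needs no choice.
\<close>

definition stem :: "(quat \<Rightarrow> quat) \<Rightarrow> complex \<Rightarrow> biquat" where
  "stem f z =
     bq_of_quat ((1/2) *\<^sub>R (f (slice_emb qi z) + f (slice_emb (- qi) z)))
     + bscal \<i> * bq_of_quat ((-1/2) *\<^sub>R (qi * (f (slice_emb qi z) - f (slice_emb (- qi) z))))"

lemma biquat_eval_re_im:
  "I \<in> qS \<Longrightarrow> biquat_eval I (bq_of_quat A + bscal \<i> * bq_of_quat B) = A + I * B"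
  by (simp add: biquat_eval_simps biquat_eval_scal_mult biquat_eval_bq_of_quat)

lemma stem_eval:
  assumes W: "slice_regular W f" "circular W" and z: "Im z > 0" "z \<in> slice_coord ` W"
    and I: "I \<in> qS"
  shows "f (slice_emb I z) = biquat_eval I (stem f z)"
proof -
  obtain F1 F2 :: "real \<Rightarrow> real \<Rightarrow> quat" where
    "\<And>x y I. I \<in> qS \<Longrightarrow> of_real x + I * of_real y \<in> W \<Longrightarrow>
       f (of_real x + I * of_real y) = F1 x y + I * F2 x y"
    using W(1) unfolding slice_regular_def by blast
  from this[of _ "Re z" "Im z"]
  have F: "f (slice_emb I z) = F1 (Re z) (Im z) + I * F2 (Re z) (Im z)" if "I \<in> qS" for I
    using that slice_emb_mem_iff[OF W(2) that z(1)] z(2) by (simp add: slice_emb_of_real_eq)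
  have "qi * (qi * q) = - q" for q :: quat
    by (simp add: mult.assoc[symmetric])
  then have "(1/2) *\<^sub>R (f (slice_emb qi z) + f (slice_emb (- qi) z)) = F1 (Re z) (Im z)"
    "(-1/2) *\<^sub>R (qi * (f (slice_emb qi z) - f (slice_emb (- qi) z))) = F2 (Re z) (Im z)"
    by (simp_all add: F[of qi] F[of "- qi"] quat_eq_iff right_diff_distrib distrib_left)
  then show ?thesis
    using I by (simp add: F stem_def biquat_eval_re_im)
qed

lemma bounded_linear_Complex_pair: "bounded_linear (\<lambda>p. Complex (fst p) (snd p))"
  unfolding Complex_eq
  by (intro bounded_linear_add bounded_linear_const_mult bounded_linear_compose[OF bounded_linear_of_real]
      bounded_linear_fst bounded_linear_snd)

lemma bounded_linear_slice_emb: "bounded_linear (slice_emb I)"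
  unfolding slice_emb_def
  by (intro bounded_linear_add bounded_linear_scaleR_const bounded_linear_scaleR_left
      bounded_linear_compose[OF bounded_linear_scaleR_left] bounded_linear_Re bounded_linear_Im)

text \<open>
  The Cauchy--Riemann equations on the slices of \<open>I\<close> and of \<open>-I\<close> together say
  \<open>\<partial>\<^sub>x F\<^sub>1 = \<partial>\<^sub>y F\<^sub>2\<close> and \<open>\<partial>\<^sub>x F\<^sub>2 = - \<partial>\<^sub>y F\<^sub>1\<close>: they are the complex
  Cauchy--Riemann equations for each coordinate.
\<close>

lemma stem_holomorphic:
  assumes reg: "slice_regular W f" and W: "open W" "circular W" "W \<inter> \<real> = {}"
    and s: "s \<in> bq_coords"
  shows "(\<lambda>z. s (stem f z)) holomorphic_on slice_coord ` W"
proof (rule holomorphic_onI)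
  fix z assume z: "z \<in> slice_coord ` W"
  then have Im: "Im z > 0" using slice_coord_image_eq[OF W(2,3)] by auto
  have slice_deriv: "\<exists>D. ((\<lambda>w. f (slice_emb I w)) has_derivative D) (at z) \<and> D 1 + I * D \<i> = 0"
    if I: "I \<in> qS" for I
  proof -
    have mem: "of_real (Re z) + I * of_real (Im z) \<in> W"
      using slice_emb_mem_iff[OF W(2) I Im] z by (simp add: slice_emb_of_real_eq)
    from reg[unfolded slice_regular_def, THEN conjunct2, rule_format, OF I mem]
    obtain D where D: "((\<lambda>(u, v). f (of_real u + I * of_real v)) has_derivative D) (at (Re z, Im z))"
      and CR: "(1/2) * (D (1, 0) + I * D (0, 1)) = 0"
      by blast
    have m: "((\<lambda>w. (Re w, Im w)) has_derivative (\<lambda>w. (Re w, Im w))) (at z)"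
      by (auto intro!: derivative_eq_intros)
    have "((\<lambda>w. f (slice_emb I w)) has_derivative (\<lambda>t. D (Re t, Im t))) (at z)"
      using has_derivative_compose[OF m D] by (simp add: slice_emb_of_real_eq)
    moreover have "D (1, 0) + I * D (0, 1) = 0"
      using CR by simp
    ultimately show ?thesis by (intro exI[of _ "\<lambda>t. D (Re t, Im t)"]) simp
  qed
  obtain P where P: "((\<lambda>w. f (slice_emb qi w)) has_derivative P) (at z)"
    and CRP: "P 1 + qi * P \<i> = 0"
    using slice_deriv[of qi] by auto
  obtain Q where Q: "((\<lambda>w. f (slice_emb (- qi) w)) has_derivative Q) (at z)"
    and CRQ: "Q 1 + (- qi) * Q \<i> = 0"
    using slice_deriv[of "- qi"] by (auto simp only: uminus_qS qi_qS)
  define A where "A t = (1/2) *\<^sub>R (P t + Q t)" for t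
  define B where "B t = (-1/2) *\<^sub>R (qi * (P t - Q t))" for t
  define F1 where "F1 w = (1/2) *\<^sub>R (f (slice_emb qi w) + f (slice_emb (- qi) w))" for w
  define F2 where "F2 w = (-1/2) *\<^sub>R (qi * (f (slice_emb qi w) - f (slice_emb (- qi) w)))" for w
  have dF: "(F1 has_derivative A) (at z)" "(F2 has_derivative B) (at z)"
    unfolding F1_def A_def F2_def B_def
    by (intro derivative_intros has_derivative_scaleR_right has_derivative_mult_right P Q)+
  have P1: "P 1 = - (qi * P \<i>)" and Q1: "Q 1 = qi * Q \<i>"
    using CRP CRQ by (simp_all add: eq_neg_iff_add_eq_0)
  have qq: "qi * (qi * q) = - q" for q :: quat
    by (simp add: mult.assoc[symmetric])
  have AB: "A 1 = B \<i>" "B 1 = - A \<i>"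
    unfolding A_def B_def P1 Q1 by (simp_all add: algebra_simps qq)
  obtain e where e: "\<And>q1 q2. s (bq_of_quat q1 + bscal \<i> * bq_of_quat q2)
      = of_real (inner q1 e) + \<i> * of_real (inner q2 e)"
  proof -
    consider "s = bq0" | "s = bq1" | "s = bq2" | "s = bq3" using s by (auto simp: bq_coords_def)
    then show ?thesis
      by cases (rule that[of 1] that[of qi] that[of qj] that[of qk],
          simp add: biquat_mult_sel inner_quat_def)+
  qed
  have "((\<lambda>w. of_real (inner (F1 w) e) + \<i> * of_real (inner (F2 w) e)) has_derivative
      (\<lambda>t. of_real (inner (A t) e) + \<i> * of_real (inner (B t) e))) (at z)"
    by (intro derivative_intros has_derivative_of_real has_derivative_inner_left dF)
  moreover have "(\<lambda>t. of_real (inner (A t) e) + \<i> * of_real (inner (B t) e))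
      = (*) (of_real (inner (A 1) e) + \<i> * of_real (inner (B 1) e))"
  proof
    fix t
    have lin: "linear A" "linear B"
      using dF has_derivative_linear by blast+
    have "t = Re t *\<^sub>R 1 + Im t *\<^sub>R \<i>"
      by (simp add: complex_eq_iff)
    then have lin': "A t = Re t *\<^sub>R A 1 + Im t *\<^sub>R A \<i>" "B t = Re t *\<^sub>R B 1 + Im t *\<^sub>R B \<i>"
      by (metis lin linear_add linear_scale)+
    show "of_real (inner (A t) e) + \<i> * of_real (inner (B t) e)
      = (of_real (inner (A 1) e) + \<i> * of_real (inner (B 1) e)) * t"
      unfolding lin' AB by (simp add: complex_eq_iff inner_add_left inner_diff_left algebra_simps)
  qed
  ultimately have "((\<lambda>w. of_real (inner (F1 w) e) + \<i> * of_real (inner (F2 w) e)) has_field_derivative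
      of_real (inner (A 1) e) + \<i> * of_real (inner (B 1) e)) (at z)"
    by (simp add: has_field_derivative_def)
  then have "(\<lambda>w. s (stem f w)) field_differentiable at z"
    unfolding stem_def e F1_def F2_def field_differentiable_def by blast
  then show "(\<lambda>w. s (stem f w)) field_differentiable at z within slice_coord ` W"
    by (rule field_differentiable_at_within)
qed

text \<open>
  The converse: on the slice of \<open>I\<close> the function is a sum of holomorphic functions of \<open>u + I v\<close>
  multiplied on the right by constants, and such functions are annihilated by \<open>\<partial>\<^sub>x + I \<partial>\<^sub>y\<close>.
\<close>

lemma slice_regular_vimage:
  assumes G: "open G" "G \<subseteq> {z. Im z > 0}"
    and hol: "\<And>s. s \<in> bq_coords \<Longrightarrow> (\<lambda>z. s (c z)) holomorphic_on G"
    and f: "\<And>z I. z \<in> G \<Longrightarrow> I \<in> qS \<Longrightarrow> f (slice_emb I z) = biquat_eval I (c z)"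
  shows "slice_regular (slice_coord -` G) f"
proof -
  define A where "A c = Quat (Re (bq0 c)) (Re (bq1 c)) (Re (bq2 c)) (Re (bq3 c))" for c
  define B where "B c = Quat (Im (bq0 c)) (Im (bq1 c)) (Im (bq2 c)) (Im (bq3 c))" for c
  have AB: "biquat_eval I c = A c + I * B c" for I c
    by (simp add: biquat_eval_def slice_emb_def A_def B_def quat_eq_iff quat_mult_sel algebra_simps)
  define F1 where "F1 x y = A (c (Complex x \<bar>y\<bar>))" for x y :: real
  define F2 where "F2 x y = sgn y *\<^sub>R B (c (Complex x \<bar>y\<bar>))" for x y :: real
  have mem: "(of_real x + I * of_real y \<in> slice_coord -` G) = (Complex x \<bar>y\<bar> \<in> G)"
    if "I \<in> qS" for I x y
    using that by (simp add: slice_emb_of_real_eq slice_coord_slice_emb)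
  have stems: "f (of_real x + I * of_real y) = F1 x y + I * F2 x y"
    if I: "I \<in> qS" and q: "of_real x + I * of_real y \<in> slice_coord -` G" for x y I
  proof -
    have G': "Complex x \<bar>y\<bar> \<in> G" using mem[OF I] q by blast
    with G(2) have "y \<noteq> 0" by auto
    show ?thesis
    proof (cases "y > 0")
      case True
      then show ?thesis using f[OF G' I] by (simp add: slice_emb_of_real_eq AB F1_def F2_def)
    next
      case False
      with \<open>y \<noteq> 0\<close> have "y < 0" by simp
      then show ?thesis
        using f[OF G', of "- I"] I
        by (simp add: slice_emb_of_real_eq AB F1_def F2_def slice_emb_def)
    qed
  qed
  have upper: "\<exists>D. ((\<lambda>(u, v). f (of_real u + I * of_real v)) has_derivative D) (at (x, y)) \<and>
      D (1, 0) + I * D (0, 1) = 0" if I: "I \<in> qS" and G': "Complex x y \<in> G" for I x y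
  proof -
    define d where "d s = deriv (\<lambda>z. s (c z)) (Complex x y)" for s :: "biquat \<Rightarrow> complex"
    define D where "D p = slice_emb I (Complex (fst p) (snd p)) * biquat_eval I (BQ (d bq0) (d bq1) (d bq2) (d bq3))" for p
    have ds: "((\<lambda>p. slice_emb I (s (c (Complex (fst p) (snd p))))) has_derivative
        (\<lambda>p. slice_emb I (d s * Complex (fst p) (snd p)))) (at (x, y))" if "s \<in> bq_coords" for s
    proof -
      have "((\<lambda>z. s (c z)) has_derivative (*) (d s)) (at (Complex (fst (x, y)) (snd (x, y))))"
        using holomorphic_derivI[OF hol[OF that] G(1) G'] unfolding d_def has_field_derivative_def
        by simp
      from has_derivative_compose[OF bounded_linear_imp_has_derivative[OF bounded_linear_Complex_pair] this]
      show ?thesis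
        by (intro bounded_linear.has_derivative[OF bounded_linear_slice_emb])
    qed
    have "((\<lambda>p. biquat_eval I (c (Complex (fst p) (snd p)))) has_derivative D) (at (x, y))"
    proof -
      have "((\<lambda>p. biquat_eval I (c (Complex (fst p) (snd p)))) has_derivative
          (\<lambda>p. slice_emb I (d bq0 * Complex (fst p) (snd p))
            + slice_emb I (d bq1 * Complex (fst p) (snd p)) * qi
            + slice_emb I (d bq2 * Complex (fst p) (snd p)) * qj
            + slice_emb I (d bq3 * Complex (fst p) (snd p)) * qk)) (at (x, y))"
        unfolding biquat_eval_def
        by (intro has_derivative_add has_derivative_mult_left ds) (simp_all add: bq_coords_def)
      also have "(\<lambda>p. slice_emb I (d bq0 * Complex (fst p) (snd p))
            + slice_emb I (d bq1 * Complex (fst p) (snd p)) * qi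
            + slice_emb I (d bq2 * Complex (fst p) (snd p)) * qj
            + slice_emb I (d bq3 * Complex (fst p) (snd p)) * qk) = D"
        by (simp add: fun_eq_iff D_def biquat_eval_def slice_emb_mult[OF I] distrib_left
            slice_emb_commute[OF I, of "d _"] mult.assoc)
      finally show ?thesis .
    qed
    moreover have "open ((\<lambda>p. Complex (fst p) (snd p)) -` G)"
      using G(1) by (intro open_vimage linear_continuous_on bounded_linear_Complex_pair)
    moreover have "(x, y) \<in> (\<lambda>p. Complex (fst p) (snd p)) -` G" using G' by simp
    moreover have "biquat_eval I (c (Complex (fst p) (snd p))) = (\<lambda>(u, v). f (of_real u + I * of_real v)) p"
      if "p \<in> (\<lambda>p. Complex (fst p) (snd p)) -` G" for p
      using f[OF _ I, of "Complex (fst p) (snd p)"] that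
      by (simp add: slice_emb_of_real_eq case_prod_beta)
    ultimately have "((\<lambda>(u, v). f (of_real u + I * of_real v)) has_derivative D) (at (x, y))"
      by (rule has_derivative_transform_within_open)
    moreover have "D (1, 0) + I * D (0, 1) = 0"
      using qS_square[OF I] by (simp add: D_def mult.assoc[symmetric] slice_emb_def)
    ultimately show ?thesis by blast
  qed
  have CR: "\<exists>D. ((\<lambda>(u, v). f (of_real u + I * of_real v)) has_derivative D) (at (x, y)) \<and>
      (1/2) * (D (1, 0) + I * D (0, 1)) = 0"
    if I: "I \<in> qS" and q: "of_real x + I * of_real y \<in> slice_coord -` G" for x y I
  proof -
    have G': "Complex x \<bar>y\<bar> \<in> G" using mem[OF I] q by blast
    show ?thesis
    proof (cases "y > 0")
      case True
      then show ?thesis using upper[OF I, of x y] G' by auto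
    next
      case False
      \<comment> \<open>The lower half of the slice of \<open>I\<close> is the upper half of the slice of \<open>-I\<close>.\<close>
      with G' obtain D where
        D: "((\<lambda>(u, v). f (of_real u + (- I) * of_real v)) has_derivative D) (at (x, - y))"
        "D (1, 0) + (- I) * D (0, 1) = 0"
        using upper[of "- I" x "- y"] I by auto
      have m: "((\<lambda>p. (fst p, - snd p)) has_derivative (\<lambda>p. (fst p, - snd p))) (at (x, y))"
        by (auto intro!: derivative_eq_intros)
      have "((\<lambda>(u, v). f (of_real u + I * of_real v)) has_derivative (\<lambda>p. D (fst p, - snd p))) (at (x, y))"
        using has_derivative_compose[OF m, of "\<lambda>(u, v). f (of_real u + (- I) * of_real v)" D] D(1)
        by (simp add: case_prod_unfold)
      moreover have "D (0, - 1) = - D (0, 1)"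
        using linear_neg[OF has_derivative_linear[OF D(1)], of "(0, 1)"] by simp
      ultimately show ?thesis
        using D(2) by (intro exI[of _ "\<lambda>p. D (fst p, - snd p)"]) simp
    qed
  qed
  have "\<forall>x y. F1 x (- y) = F1 x y" "\<forall>x y. F2 x (- y) = - F2 x y"
    by (simp_all add: F1_def F2_def sgn_minus)
  with stems CR show ?thesis
    unfolding slice_regular_def by blast
qed

section \<open>Semi-regular functions and meromorphic stem functions\<close>

text \<open>
  All sufficiently large exponents are allowed, so that one exponent serves four coordinates.
\<close>

lemma meromorphic_clear_pole:
  assumes "f meromorphic_on {z}"
  shows "\<exists>n. \<forall>m\<ge>n. \<exists>g. g analytic_on {z} \<and> (\<forall>\<^sub>F w in at z. g w = (w - z) ^ m * f w)"
proof (cases "\<exists>\<^sub>F w in at z. f w \<noteq> 0")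
  case False
  then have "\<forall>\<^sub>F w in at z. f w = 0" by (simp add: frequently_def)
  then have "\<forall>\<^sub>F w in at z. 0 = (w - z) ^ m * f w" for m
    by eventually_elim simp
  then show ?thesis by (intro exI[of _ 0] allI impI exI[of _ "\<lambda>_. 0"]) simp
next
  case True
  define k where "k = zorder f z"
  define g where "g = zor_poly f z"
  obtain r where r: "r > 0" "g holomorphic_on cball z r"
      "\<And>w. w \<in> cball z r - {z} \<Longrightarrow> f w = g w * (w - z) powi k"
    using zorder_exist[of f z] True assms meromorphic_at_iff unfolding g_def k_def by blast
  have *: "\<exists>g. g analytic_on {z} \<and> (\<forall>\<^sub>F w in at z. g w = (w - z) ^ m * f w)" if m: "m \<ge> nat (- k)" for m
  proof -
    define h where "h w = (w - z) ^ nat (int m + k) * g w" for w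
    have "h holomorphic_on ball z r"
      unfolding h_def by (intro holomorphic_intros holomorphic_on_subset[OF r(2)]) auto
    then have "h analytic_on {z}"
      using r(1) by (meson analytic_at centre_in_ball open_ball)
    moreover have "h w = (w - z) ^ m * f w" if w: "w \<in> ball z r" "w \<noteq> z" for w
    proof -
      have "(w - z) ^ nat (int m + k) = (w - z) powi (int m + k)"
        using m by (simp add: power_int_def)
      also have "\<dots> = (w - z) ^ m * (w - z) powi k"
        using w by (simp add: power_int_add)
      finally show ?thesis using r(3)[of w] w by (simp add: h_def)
    qed
    then have "\<forall>\<^sub>F w in at z. h w = (w - z) ^ m * f w"
      using r(1) by (intro eventually_at_topological[THEN iffD2] exI[of _ "ball z r"]) auto
    ultimately show ?thesis by blast
  qed
  then show ?thesis by blast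
qed

lemma finite_bq_coords: "finite bq_coords"
  by (simp add: bq_coords_def)

definition bq_meromorphic :: "(complex \<Rightarrow> biquat) \<Rightarrow> complex set \<Rightarrow> bool" where
  "bq_meromorphic c A \<longleftrightarrow> (\<forall>s\<in>bq_coords. (\<lambda>z. s (c z)) meromorphic_on A)"

lemma bq_meromorphicI:
  assumes "(\<lambda>z. bq0 (c z)) meromorphic_on A" "(\<lambda>z. bq1 (c z)) meromorphic_on A"
    "(\<lambda>z. bq2 (c z)) meromorphic_on A" "(\<lambda>z. bq3 (c z)) meromorphic_on A"
  shows "bq_meromorphic c A"
  using assms by (simp add: bq_meromorphic_def bq_coords_def)

lemma bq_meromorphic_intros [intro]:
  "bq_meromorphic (\<lambda>_. b) A"
  "w meromorphic_on A \<Longrightarrow> bq_meromorphic (\<lambda>z. bscal (w z)) A"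
  "bq_meromorphic c A \<Longrightarrow> bq_meromorphic d A \<Longrightarrow> bq_meromorphic (\<lambda>z. c z + d z) A"
  "bq_meromorphic c A \<Longrightarrow> bq_meromorphic d A \<Longrightarrow> bq_meromorphic (\<lambda>z. c z - d z) A"
  "bq_meromorphic c A \<Longrightarrow> bq_meromorphic d A \<Longrightarrow> bq_meromorphic (\<lambda>z. c z * d z) A"
  "bq_meromorphic c A \<Longrightarrow> bq_meromorphic (\<lambda>z. - c z) A"
  "bq_meromorphic c A \<Longrightarrow> bq_meromorphic (\<lambda>z. bconj (c z)) A"
  "bq_meromorphic c A \<Longrightarrow> bq_meromorphic (\<lambda>z. bvec (c z)) A"
  unfolding bq_meromorphic_def bq_coords_def
  by (auto intro!: meromorphic_intros simp: biquat_mult_sel)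

lemma bq_meromorphicD [meromorphic_intros]:
  assumes "bq_meromorphic c A"
  shows "(\<lambda>z. bq0 (c z)) meromorphic_on A" "(\<lambda>z. bq1 (c z)) meromorphic_on A"
    "(\<lambda>z. bq2 (c z)) meromorphic_on A" "(\<lambda>z. bq3 (c z)) meromorphic_on A"
  using assms by (simp_all add: bq_meromorphic_def bq_coords_def)

lemma bdot_meromorphic [meromorphic_intros]:
  "bq_meromorphic c A \<Longrightarrow> bq_meromorphic d A \<Longrightarrow> (\<lambda>z. bdot (c z) (d z)) meromorphic_on A"
  unfolding bdot_def by (intro meromorphic_intros)

text \<open>
  Off the real axis \<open>\<J> q\<close> is the unit of the slice through \<open>q\<close> for which \<open>q\<close> lies in the
  upper half.
\<close>

definition lift :: "(complex \<Rightarrow> biquat) \<Rightarrow> quat \<Rightarrow> quat" where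
  "lift c q = biquat_eval (\<J> q) (c (slice_coord q))"

lemma lift_slice_emb: "I \<in> qS \<Longrightarrow> Im z > 0 \<Longrightarrow> lift c (slice_emb I z) = biquat_eval I (c z)"
  by (simp add: lift_def)

locale product_dom =
  fixes \<Omega> :: "quat set"
  assumes product_domain: "product_domain \<Omega>"
begin

definition D :: "complex set" where
  "D = slice_coord ` \<Omega>"

lemma open_\<Omega>: "open \<Omega>" and circular_\<Omega>: "circular \<Omega>" and nonreal_\<Omega>: "\<Omega> \<inter> \<real> = {}"
  using product_domain by (auto simp: product_domain_def)

lemma open_D [simp]: "open D"
  unfolding D_def using open_\<Omega> circular_\<Omega> nonreal_\<Omega> by (rule open_slice_coord_image)

lemma connected_D: "connected D"
  unfolding D_def using product_domain
  by (intro connected_continuous_image continuous_on_slice_coord) (simp add: product_domain_def)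

lemma D_nonempty: "D \<noteq> {}"
  using product_domain by (simp add: D_def product_domain_def)

lemma D_upper: "z \<in> D \<Longrightarrow> Im z > 0"
  using slice_coord_image_eq[OF circular_\<Omega> nonreal_\<Omega>] by (auto simp: D_def)

lemma mem_\<Omega>_iff: "q \<in> \<Omega> \<longleftrightarrow> slice_coord q \<in> D"
  unfolding D_def using circular_mem_iff[OF circular_\<Omega>] .

lemma eventually_D: "\<forall>\<^sub>\<approx>z\<in>D. z \<in> D"
  by (rule eventually_in_cosparse) auto

text \<open>
  A sparse set of points of \<open>D\<close> is ignored, matching the identification of semi-regular functions
  that agree where both are defined; the values of \<open>f\<close> at poles are arbitrary.
\<close>

definition has_stem :: "(quat \<Rightarrow> quat) \<Rightarrow> (complex \<Rightarrow> biquat) \<Rightarrow> bool" where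
  "has_stem f c \<longleftrightarrow>
     bq_meromorphic c D \<and> (\<forall>\<^sub>\<approx>z\<in>D. \<forall>I\<in>qS. f (slice_emb I z) = biquat_eval I (c z))"

lemma has_stem_unique:
  assumes "has_stem f c" "has_stem f d"
  shows "\<forall>\<^sub>\<approx>z\<in>D. c z = d z"
proof -
  have "\<forall>\<^sub>\<approx>z\<in>D. \<forall>I\<in>qS. f (slice_emb I z) = biquat_eval I (c z)"
    "\<forall>\<^sub>\<approx>z\<in>D. \<forall>I\<in>qS. f (slice_emb I z) = biquat_eval I (d z)"
    using assms by (simp_all add: has_stem_def)
  then show ?thesis by eventually_elim (auto intro: biquat_eval_inject)
qed

lemma has_stem_cong:
  assumes c: "has_stem f c" and cd: "\<forall>\<^sub>\<approx>z\<in>D. c z = d z"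
  shows "has_stem f d"
proof -
  have "(\<lambda>z. s (d z)) meromorphic_on D" if "s \<in> bq_coords" for s
  proof -
    have "\<forall>\<^sub>\<approx>z\<in>D. s (c z) = s (d z)" using cd by eventually_elim simp
    then have "((\<lambda>z. s (c z)) meromorphic_on D) = ((\<lambda>z. s (d z)) meromorphic_on D)"
      by (rule meromorphic_on_cong') simp
    then show ?thesis using c that by (simp add: has_stem_def bq_meromorphic_def)
  qed
  moreover have "\<forall>\<^sub>\<approx>z\<in>D. \<forall>I\<in>qS. f (slice_emb I z) = biquat_eval I (d z)"
  proof -
    have "\<forall>\<^sub>\<approx>z\<in>D. \<forall>I\<in>qS. f (slice_emb I z) = biquat_eval I (c z)" using c by (simp add: has_stem_def)
    with cd show ?thesis by eventually_elim simp
  qed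
  ultimately show ?thesis by (simp add: has_stem_def bq_meromorphic_def)
qed

text \<open>
  Near a missing sphere the stem function is a holomorphic stem function divided by a power of
  \<open>(w - z)(w - cnj z)\<close>, and the second factor has no zero in the upper half plane.
\<close>

lemma regularity_domain_stem:
  assumes "regularity_domain \<Omega> f W"
  shows "\<forall>\<^sub>\<approx>z\<in>D. z \<in> slice_coord ` W" and "has_stem f (stem f)"
proof -
  have W: "open W" "circular W" "W \<subseteq> \<Omega>" "slice_regular W f"
    and isolated: "\<And>p. p \<in> \<Omega> - W \<Longrightarrow> \<exists>U. open U \<and> circular U \<and> p \<in> U \<and> U \<subseteq> \<Omega> \<and> U - qsphere p \<subseteq> W \<and>
        (\<exists>(m::nat) g. slice_regular U g \<and> (\<forall>q\<in>U - qsphere p. g q = qDelta p q ^ m * f q))"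
    using assms by (auto simp: regularity_domain_def)
  have WR: "W \<inter> \<real> = {}" using W(3) nonreal_\<Omega> by blast
  have openW: "open (slice_coord ` W)" by (rule open_slice_coord_image) fact+
  have WD: "slice_coord ` W \<subseteq> D" using W(3) by (auto simp: D_def)
  have sing: "\<exists>V g (m::nat). open V \<and> z \<in> V \<and> V - {z} \<subseteq> slice_coord ` W \<and>
      bq_meromorphic g {z} \<and> (\<forall>w\<in>V - {z}. g w = bscal (((w - z) * (w - cnj z)) ^ m) * stem f w)"
    if z: "z \<in> D" "z \<notin> slice_coord ` W" for z
  proof -
    define p where "p = slice_emb qi z"
    have Im: "Im z > 0" using D_upper z by blast
    have p: "p \<in> \<Omega> - W" "slice_coord p = z"
      using z Im slice_emb_mem_iff[OF W(2) qi_qS Im] by (simp_all add: p_def mem_\<Omega>_iff)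
    obtain U g and m :: nat where U: "open U" "circular U" "p \<in> U" "U \<subseteq> \<Omega>" "U - qsphere p \<subseteq> W"
      and g: "slice_regular U g" "\<And>q. q \<in> U - qsphere p \<Longrightarrow> g q = qDelta p q ^ m * f q"
      using isolated[OF p(1)] by blast
    have UR: "U \<inter> \<real> = {}" using U(4) nonreal_\<Omega> by blast
    have openU: "open (slice_coord ` U)" by (rule open_slice_coord_image) fact+
    have zU: "z \<in> slice_coord ` U" using U(3) p(2) by blast
    have off: "slice_emb I w \<in> U - qsphere p" "Im w > 0"
      if "w \<in> slice_coord ` U - {z}" "I \<in> qS" for w I
    proof -
      show Im: "Im w > 0" using that D_upper U(4) by (auto simp: D_def)
      show "slice_emb I w \<in> U - qsphere p"
        using that slice_emb_mem_iff[OF U(2) that(2) Im] Im p(2) by (simp add: mem_qsphere_iff)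
    qed
    have sub: "slice_coord ` U - {z} \<subseteq> slice_coord ` W"
      using off[of _ qi] U(5) slice_emb_mem_iff[OF W(2) qi_qS] by auto
    have "bq_meromorphic (stem g) {z}"
      unfolding bq_meromorphic_def
    proof
      fix s assume "s \<in> bq_coords"
      then have "(\<lambda>w. s (stem g w)) holomorphic_on slice_coord ` U"
        by (rule stem_holomorphic[OF g(1) U(1,2) UR])
      then show "(\<lambda>w. s (stem g w)) meromorphic_on {z}"
        using openU zU by (meson analytic_at analytic_on_imp_meromorphic_on)
    qed
    moreover have "stem g w = bscal (((w - z) * (w - cnj z)) ^ m) * stem f w"
      if w: "w \<in> slice_coord ` U - {z}" for w
    proof (rule biquat_eval_inject)
      fix I assume I: "I \<in> qS"
      have "biquat_eval I (stem g w) = g (slice_emb I w)"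
        using stem_eval[OF g(1) U(2) off(2)[OF w I] _ I] w by simp
      also have "\<dots> = slice_emb I (((w - z) * (w - cnj z)) ^ m) * f (slice_emb I w)"
        using g(2)[OF off(1)[OF w I]] by (simp add: qDelta_slice_emb[OF I] slice_emb_power[OF I] p(2))
      also have "f (slice_emb I w) = biquat_eval I (stem f w)"
        using stem_eval[OF W(4,2) off(2)[OF w I] _ I] sub w by blast
      finally show "biquat_eval I (stem g w) = biquat_eval I (bscal (((w - z) * (w - cnj z)) ^ m) * stem f w)"
        by (simp add: biquat_eval_scal_mult[OF I])
    qed
    ultimately show ?thesis using openU zU sub by blast
  qed
  show cosparse: "\<forall>\<^sub>\<approx>z\<in>D. z \<in> slice_coord ` W"
    unfolding eventually_cosparse_open_eq[OF open_D]
  proof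
    fix z assume z: "z \<in> D"
    show "\<forall>\<^sub>F w in at z. w \<in> slice_coord ` W"
    proof (cases "z \<in> slice_coord ` W")
      case True
      then show ?thesis using openW by (meson eventually_at_topological)
    next
      case False
      then show ?thesis using sing[OF z] unfolding eventually_at_topological by blast
    qed
  qed
  have "(\<lambda>w. s (stem f w)) meromorphic_on D" if s: "s \<in> bq_coords" for s
    unfolding meromorphic_on_meromorphic_at[of _ D]
  proof
    fix z assume z: "z \<in> D"
    show "(\<lambda>w. s (stem f w)) meromorphic_on {z}"
    proof (cases "z \<in> slice_coord ` W")
      case True
      then show ?thesis
        using stem_holomorphic[OF W(4,1,2) WR s] openW
        by (meson analytic_at analytic_on_imp_meromorphic_on)
    next
      case False
      then obtain V g and m :: nat where V: "open V" "z \<in> V" "V - {z} \<subseteq> slice_coord ` W"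
        "bq_meromorphic g {z}"
        and g: "\<And>w. w \<in> V - {z} \<Longrightarrow> g w = bscal (((w - z) * (w - cnj z)) ^ m) * stem f w"
        using sing[OF z] by metis
      have "\<forall>\<^sub>F w in at z. s (stem f w) = inverse (((w - z) * (w - cnj z)) ^ m) * s (g w)"
        unfolding eventually_at_topological
      proof (intro exI conjI ballI impI)
        fix w assume w: "w \<in> V" "w \<noteq> z"
        then have "Im w > 0" using V(3) WD D_upper by blast
        then have "w \<noteq> cnj z" using D_upper[OF z] by auto
        then have "((w - z) * (w - cnj z)) ^ m \<noteq> 0" using w by simp
        moreover have "s (g w) = ((w - z) * (w - cnj z)) ^ m * s (stem f w)"
          using g[of w] w s by (auto simp: bq_coords_def biquat_mult_sel)
        ultimately show "s (stem f w) = inverse (((w - z) * (w - cnj z)) ^ m) * s (g w)"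
          by (metis left_inverse mult.assoc mult_1)
      qed fact+
      moreover have "(\<lambda>w. inverse (((w - z) * (w - cnj z)) ^ m) * s (g w)) meromorphic_on {z}"
        using V(4) s by (intro meromorphic_intros) (auto simp: bq_meromorphic_def)
      ultimately show ?thesis
        using meromorphic_on_cong[of "{z}" "\<lambda>w. s (stem f w)"] by fastforce
    qed
  qed
  moreover have "\<forall>\<^sub>\<approx>z\<in>D. \<forall>I\<in>qS. f (slice_emb I z) = biquat_eval I (stem f z)"
    using cosparse eventually_D
    by eventually_elim (use stem_eval[OF W(4,2)] D_upper in blast)
  ultimately show "has_stem f (stem f)"
    by (simp add: has_stem_def bq_meromorphic_def)
qed

text \<open>
  The domain of regularity consists of the spheres near which the stem function is analytic and
  \<open>f\<close> agrees with it.  At the remaining spheres, which are isolated, \<open>\<Delta>\<^sub>p ^ m\<close> clears the poles of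
  all four coordinates at once.
\<close>

lemma has_stem_regularity_domain:
  assumes "has_stem f c"
  obtains W where "regularity_domain \<Omega> f W"
    "\<And>z I. z \<in> slice_coord ` W \<Longrightarrow> I \<in> qS \<Longrightarrow> f (slice_emb I z) = biquat_eval I (c z)"
proof -
  have mero: "\<And>s. s \<in> bq_coords \<Longrightarrow> (\<lambda>z. s (c z)) meromorphic_on D"
    and agree: "\<forall>\<^sub>\<approx>z\<in>D. \<forall>I\<in>qS. f (slice_emb I z) = biquat_eval I (c z)"
    using assms by (auto simp: has_stem_def bq_meromorphic_def)
  define P where "P z \<longleftrightarrow> z \<in> D \<and> (\<forall>I\<in>qS. f (slice_emb I z) = biquat_eval I (c z)) \<and>
    (\<forall>s\<in>bq_coords. (\<lambda>z. s (c z)) analytic_on {z})" for z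
  have "\<forall>s\<in>bq_coords. \<forall>\<^sub>\<approx>z\<in>D. (\<lambda>z. s (c z)) analytic_on {z}"
    using mero meromorphic_on_imp_analytic_cosparse by blast
  then have analytic: "\<forall>\<^sub>\<approx>z\<in>D. \<forall>s\<in>bq_coords. (\<lambda>z. s (c z)) analytic_on {z}"
    by (rule eventually_ball_finite[OF finite_bq_coords])
  have "\<forall>\<^sub>\<approx>z\<in>D. z \<in> D \<and> (\<forall>I\<in>qS. f (slice_emb I z) = biquat_eval I (c z)) \<and>
      (\<forall>s\<in>bq_coords. (\<lambda>z. s (c z)) analytic_on {z})"
    by (intro eventually_conj eventually_D agree analytic)
  then have P: "\<forall>\<^sub>\<approx>z\<in>D. P z"
    unfolding P_def .
  define G where "G = interior {z. P z}"
  have G: "open G" "G \<subseteq> D" and GP: "\<And>z. z \<in> G \<Longrightarrow> P z"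
    using interior_subset[of "{z. P z}"] by (auto simp: G_def P_def)
  have punctured: "\<forall>\<^sub>F w in at z. w \<in> G" if "z \<in> D" for z
  proof -
    have "\<forall>\<^sub>F w in at z. P w"
      using P that eventually_cosparse_open_eq[OF open_D] by blast
    then obtain S where S: "open S" "z \<in> S" "\<And>w. w \<in> S \<Longrightarrow> w \<noteq> z \<Longrightarrow> P w"
      unfolding eventually_at_topological by blast
    then have "S - {z} \<subseteq> G"
      unfolding G_def by (intro interior_maximal) auto
    with S show ?thesis unfolding eventually_at_topological by blast
  qed
  define W where "W = slice_coord -` G"
  have upper: "G \<subseteq> {z. Im z > 0}" using G(2) D_upper by blast
  have coordW: "slice_coord ` W = G"
  proof -
    have "z \<in> slice_coord ` W" if "z \<in> G" for z
      using that upper by (intro image_eqI[of _ _ "slice_emb qi z"]) (auto simp: W_def)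
    then show ?thesis by (auto simp: W_def)
  qed
  have openW: "open W" and circularW: "circular W" and W\<Omega>: "W \<subseteq> \<Omega>"
    using G by (auto simp: W_def open_vimage_slice_coord circular_vimage_slice_coord mem_\<Omega>_iff)
  have regW: "slice_regular W f"
    unfolding W_def
  proof (rule slice_regular_vimage[OF G(1) upper])
    fix s assume "s \<in> bq_coords"
    then have "(\<lambda>z. s (c z)) analytic_on G"
      using GP by (subst analytic_on_analytic_at) (auto simp: P_def)
    then show "(\<lambda>z. s (c z)) holomorphic_on G" by (rule analytic_imp_holomorphic)
  next
    fix z I assume "z \<in> G" "I \<in> qS"
    then show "f (slice_emb I z) = biquat_eval I (c z)" using GP by (auto simp: P_def)
  qed
  have poles: "\<exists>U. open U \<and> circular U \<and> p \<in> U \<and> U \<subseteq> \<Omega> \<and> U - qsphere p \<subseteq> W \<and>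
      (\<exists>(m::nat) g. slice_regular U g \<and> (\<forall>q\<in>U - qsphere p. g q = qDelta p q ^ m * f q))"
    if p: "p \<in> \<Omega> - W" for p
  proof -
    define z where "z = slice_coord p"
    have z: "z \<in> D" using p by (simp add: z_def mem_\<Omega>_iff)
    have "\<exists>n. \<forall>m\<ge>n. \<exists>g. g analytic_on {z} \<and> (\<forall>\<^sub>F w in at z. g w = (w - z) ^ m * s (c w))"
      if "s \<in> bq_coords" for s
      using mero[OF that] z by (intro meromorphic_clear_pole) (auto intro: meromorphic_on_subset)
    then obtain n where n: "\<And>s m. s \<in> bq_coords \<Longrightarrow> m \<ge> n s \<Longrightarrow>
        \<exists>g. g analytic_on {z} \<and> (\<forall>\<^sub>F w in at z. g w = (w - z) ^ m * s (c w))"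
      by metis
    have "\<exists>m. \<forall>s\<in>bq_coords. n s \<le> m"
      by (rule exI[of _ "n bq0 + n bq1 + n bq2 + n bq3"]) (auto simp: bq_coords_def)
    then obtain m where "\<And>s. s \<in> bq_coords \<Longrightarrow> n s \<le> m" by blast
    with n have "\<forall>s\<in>bq_coords. \<exists>g. g analytic_on {z} \<and> (\<forall>\<^sub>F w in at z. g w = (w - z) ^ m * s (c w))"
      by blast
    from bchoice[OF this] obtain g where g: "\<And>s. s \<in> bq_coords \<Longrightarrow> g s analytic_on {z}"
      "\<And>s. s \<in> bq_coords \<Longrightarrow> \<forall>\<^sub>F w in at z. g s w = (w - z) ^ m * s (c w)"
      by blast
    have "\<forall>\<^sub>F w in nhds z. \<forall>s\<in>bq_coords. g s analytic_on {w}"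
    proof (intro eventually_ball_finite ballI finite_bq_coords)
      fix s assume "s \<in> bq_coords"
      then obtain S where "open S" "z \<in> S" "g s holomorphic_on S"
        using g(1) by (meson analytic_at)
      then show "\<forall>\<^sub>F w in nhds z. g s analytic_on {w}"
        unfolding eventually_nhds by (meson analytic_at)
    qed
    then obtain r1 where r1: "r1 > 0" "\<And>w s. w \<in> ball z r1 \<Longrightarrow> s \<in> bq_coords \<Longrightarrow> g s analytic_on {w}"
      unfolding eventually_nhds_metric by (auto simp: dist_commute)
    have "\<forall>\<^sub>F w in at z. w \<in> G \<and> (\<forall>s\<in>bq_coords. g s w = (w - z) ^ m * s (c w))"
      using g(2) by (intro eventually_conj punctured z eventually_ball_finite ballI finite_bq_coords) auto
    then obtain r2 where r2: "r2 > 0"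
      "\<And>w. w \<in> ball z r2 \<Longrightarrow> w \<noteq> z \<Longrightarrow> w \<in> G"
      "\<And>w s. w \<in> ball z r2 \<Longrightarrow> w \<noteq> z \<Longrightarrow> s \<in> bq_coords \<Longrightarrow> g s w = (w - z) ^ m * s (c w)"
      unfolding eventually_at by (force simp: dist_commute)
    define B where "B = ball z (min r1 r2)"
    have "w \<in> G" if "w \<in> B" "w \<noteq> z" for w
      using that r2(2) by (simp add: B_def)
    then have BG: "B - {z} \<subseteq> G" by blast
    have B: "open B" "z \<in> B"
      "\<And>w s. w \<in> B \<Longrightarrow> s \<in> bq_coords \<Longrightarrow> g s analytic_on {w}"
      "\<And>w s. w \<in> B - {z} \<Longrightarrow> s \<in> bq_coords \<Longrightarrow> g s w = (w - z) ^ m * s (c w)"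
      using r1 r2(1,3) by (auto simp: B_def)
    have BD: "B \<subseteq> D" using BG G(2) z by blast
    define k where "k w = bscal ((w - cnj z) ^ m) * BQ (g bq0 w) (g bq1 w) (g bq2 w) (g bq3 w)" for w
    define U where "U = slice_coord -` B"
    have "slice_regular U (lift k)"
      unfolding U_def
    proof (rule slice_regular_vimage[OF B(1), where c = k])
      show "B \<subseteq> {z. Im z > 0}" using BD D_upper by blast
      fix s assume s: "s \<in> bq_coords"
      have "g s holomorphic_on B"
        using B(3) s by (intro analytic_imp_holomorphic) (auto simp: analytic_on_analytic_at[of _ B])
      moreover have "(\<lambda>w. s (k w)) = (\<lambda>w. (w - cnj z) ^ m * g s w)"
        using s by (auto simp: k_def bq_coords_def biquat_mult_sel)
      ultimately show "(\<lambda>w. s (k w)) holomorphic_on B"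
        by (auto intro!: holomorphic_intros)
    next
      fix w I assume "w \<in> B" "I \<in> qS"
      then show "lift k (slice_emb I w) = biquat_eval I (k w)"
        using BD D_upper by (intro lift_slice_emb) auto
    qed
    moreover have "lift k q = qDelta p q ^ m * f q" if q: "q \<in> U - qsphere p" for q
    proof -
      define w where "w = slice_coord q"
      obtain I where I: "I \<in> qS" "q = slice_emb I w"
        unfolding w_def by (rule quat_slice_emb_exhaust)
      have w: "w \<in> B - {z}" using q by (auto simp: w_def U_def z_def mem_qsphere_iff)
      then have Im: "Im w > 0" using BD D_upper by blast
      have "BQ (g bq0 w) (g bq1 w) (g bq2 w) (g bq3 w) = bscal ((w - z) ^ m) * c w"
        using B(4)[OF w] by (simp add: biquat_eq_iff biquat_mult_sel bq_coords_def)
      then have k: "k w = bscal (((w - z) * (w - cnj z)) ^ m) * c w"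
        by (simp add: k_def biquat_eq_iff biquat_mult_sel power_mult_distrib)
      have "lift k q = slice_emb I (((w - z) * (w - cnj z)) ^ m) * biquat_eval I (c w)"
        using I(1) Im by (simp add: I(2) lift_slice_emb k biquat_eval_scal_mult)
      also have "biquat_eval I (c w) = f q"
        using GP[of w] BG w I by (auto simp: P_def)
      finally show ?thesis
        by (simp add: I(2) qDelta_slice_emb[OF I(1)] slice_emb_power[OF I(1)] z_def)
    qed
    moreover have "open U" "circular U" "p \<in> U" "U \<subseteq> \<Omega>" "U - qsphere p \<subseteq> W"
      using B(1,2) BG BD
      by (auto simp: U_def open_vimage_slice_coord circular_vimage_slice_coord z_def mem_\<Omega>_iff W_def mem_qsphere_iff)
    ultimately show ?thesis by blast
  qed
  have "regularity_domain \<Omega> f W"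
    unfolding regularity_domain_def using openW circularW W\<Omega> regW poles by blast
  moreover have "f (slice_emb I z) = biquat_eval I (c z)" if "z \<in> slice_coord ` W" "I \<in> qS" for z I
    using that GP unfolding coordW P_def by blast
  ultimately show ?thesis using that by blast
qed

lemma SEM_iff: "f \<in> SEM \<Omega> \<longleftrightarrow> (\<exists>c. has_stem f c)"
  unfolding SEM_def using regularity_domain_stem(2) has_stem_regularity_domain by blast

lemma sem_eq_common_stem:
  assumes "f \<simeq>\<^bsub>\<Omega>\<^esub> g"
  obtains c where "has_stem f c" "has_stem g c"
proof -
  obtain V W where V: "regularity_domain \<Omega> f V" and W: "regularity_domain \<Omega> g W"
    and fg: "\<And>q. q \<in> V \<Longrightarrow> q \<in> W \<Longrightarrow> f q = g q"
    using assms by (auto simp: sem_eq_def)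
  have "\<forall>\<^sub>\<approx>z\<in>D. stem f z = stem g z"
    using regularity_domain_stem(1)[OF V] regularity_domain_stem(1)[OF W] eventually_D
  proof eventually_elim
    case (elim z)
    then have "slice_emb I z \<in> V" "slice_emb I z \<in> W" if "I \<in> qS" for I
      using V W that D_upper slice_emb_mem_iff by (auto simp: regularity_domain_def)
    then have "f (slice_emb I z) = g (slice_emb I z)" if "I \<in> qS" for I
      using fg that by blast
    then show ?case by (simp add: stem_def)
  qed
  then have "has_stem f (stem g)"
    by (rule has_stem_cong[OF regularity_domain_stem(2)[OF V]])
  then show ?thesis using that regularity_domain_stem(2)[OF W] by blast
qed

lemma sem_eqI:
  assumes "has_stem f c" "has_stem g c"
  shows "f \<simeq>\<^bsub>\<Omega>\<^esub> g"
proof -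
  obtain V where V: "regularity_domain \<Omega> f V"
    "\<And>z I. z \<in> slice_coord ` V \<Longrightarrow> I \<in> qS \<Longrightarrow> f (slice_emb I z) = biquat_eval I (c z)"
    using has_stem_regularity_domain[OF assms(1)] by blast
  obtain W where W: "regularity_domain \<Omega> g W"
    "\<And>z I. z \<in> slice_coord ` W \<Longrightarrow> I \<in> qS \<Longrightarrow> g (slice_emb I z) = biquat_eval I (c z)"
    using has_stem_regularity_domain[OF assms(2)] by blast
  have "f q = g q" if "q \<in> V \<inter> W" for q
  proof -
    obtain I where I: "I \<in> qS" "q = slice_emb I (slice_coord q)" by (rule quat_slice_emb_exhaust)
    then show ?thesis using V(2)[of "slice_coord q" I] W(2)[of "slice_coord q" I] that by auto
  qed
  with V(1) W(1) show ?thesis unfolding sem_eq_def by blast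
qed

lemma sem_eq_iff:
  assumes "has_stem f c" "has_stem g d"
  shows "f \<simeq>\<^bsub>\<Omega>\<^esub> g \<longleftrightarrow> (\<forall>\<^sub>\<approx>z\<in>D. c z = d z)"
proof
  assume "f \<simeq>\<^bsub>\<Omega>\<^esub> g"
  then obtain b where b: "has_stem f b" "has_stem g b" by (rule sem_eq_common_stem)
  have "\<forall>\<^sub>\<approx>z\<in>D. c z = b z" "\<forall>\<^sub>\<approx>z\<in>D. d z = b z"
    using has_stem_unique assms b by blast+
  then show "\<forall>\<^sub>\<approx>z\<in>D. c z = d z" by eventually_elim simp
next
  assume "\<forall>\<^sub>\<approx>z\<in>D. c z = d z"
  then show "f \<simeq>\<^bsub>\<Omega>\<^esub> g"
    using assms has_stem_cong sem_eqI by blast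
qed

end

section \<open>Stem functions of the algebra operations\<close>

context product_dom begin

lemma has_stem_in_SEM: "has_stem f c \<Longrightarrow> f \<in> SEM \<Omega>"
  using SEM_iff by blast

lemma has_stem_meromorphic: "has_stem f c \<Longrightarrow> bq_meromorphic c D"
  by (simp add: has_stem_def)

lemma has_stemI:
  assumes "bq_meromorphic c D" "\<And>z I. z \<in> D \<Longrightarrow> I \<in> qS \<Longrightarrow> f (slice_emb I z) = biquat_eval I (c z)"
  shows "has_stem f c"
  unfolding has_stem_def
proof
  show "\<forall>\<^sub>\<approx>z\<in>D. \<forall>I\<in>qS. f (slice_emb I z) = biquat_eval I (c z)"
    using eventually_D by eventually_elim (use assms(2) in blast)
qed fact

lemma has_stem_map:
  assumes "has_stem f c" "bq_meromorphic d D"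
    and "\<And>z I. z \<in> D \<Longrightarrow> I \<in> qS \<Longrightarrow> f (slice_emb I z) = biquat_eval I (c z) \<Longrightarrow>
           g (slice_emb I z) = biquat_eval I (d z)"
  shows "has_stem g d"
  unfolding has_stem_def
proof
  have "\<forall>\<^sub>\<approx>z\<in>D. \<forall>I\<in>qS. f (slice_emb I z) = biquat_eval I (c z)"
    using assms(1) by (simp add: has_stem_def)
  then show "\<forall>\<^sub>\<approx>z\<in>D. \<forall>I\<in>qS. g (slice_emb I z) = biquat_eval I (d z)"
    using eventually_D by eventually_elim (use assms(3) in blast)
qed fact

lemma has_stem_map2:
  assumes "has_stem f c" "has_stem f' c'" "bq_meromorphic d D"
    and "\<And>z I. z \<in> D \<Longrightarrow> I \<in> qS \<Longrightarrow> \<forall>I\<in>qS. f (slice_emb I z) = biquat_eval I (c z) \<Longrightarrow>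
           \<forall>I\<in>qS. f' (slice_emb I z) = biquat_eval I (c' z) \<Longrightarrow>
           g (slice_emb I z) = biquat_eval I (d z)"
  shows "has_stem g d"
  unfolding has_stem_def
proof
  have "\<forall>\<^sub>\<approx>z\<in>D. \<forall>I\<in>qS. f (slice_emb I z) = biquat_eval I (c z)"
    "\<forall>\<^sub>\<approx>z\<in>D. \<forall>I\<in>qS. f' (slice_emb I z) = biquat_eval I (c' z)"
    using assms(1,2) by (simp_all add: has_stem_def)
  then show "\<forall>\<^sub>\<approx>z\<in>D. \<forall>I\<in>qS. g (slice_emb I z) = biquat_eval I (d z)"
    using eventually_D by eventually_elim (use assms(4) in blast)
qed fact

lemma has_stem_lift: "bq_meromorphic c D \<Longrightarrow> has_stem (lift c) c"
  by (rule has_stemI) (auto simp: lift_slice_emb D_upper)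

lemma has_stem_add:
  assumes "has_stem f c" "has_stem g d"
  shows "has_stem (\<lambda>q. f q + g q) (\<lambda>z. c z + d z)"
  by (rule has_stem_map2[OF assms])
     (use assms in \<open>auto intro!: bq_meromorphic_intros simp: has_stem_meromorphic biquat_eval_simps\<close>)

lemma has_stem_diff:
  assumes "has_stem f c" "has_stem g d"
  shows "has_stem (\<lambda>q. f q - g q) (\<lambda>z. c z - d z)"
  by (rule has_stem_map2[OF assms])
     (use assms in \<open>auto intro!: bq_meromorphic_intros simp: has_stem_meromorphic biquat_eval_simps\<close>)

lemma has_stem_star:
  assumes "has_stem f c" "has_stem g d"
  shows "has_stem (f \<star> g) (\<lambda>z. c z * d z)"
proof (rule has_stem_map2[OF assms])
  show "bq_meromorphic (\<lambda>z. c z * d z) D"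
    using assms by (auto intro!: bq_meromorphic_intros simp: has_stem_meromorphic)
  fix z I assume I: "I \<in> qS" and f: "\<forall>I\<in>qS. f (slice_emb I z) = biquat_eval I (c z)"
    and g: "\<forall>I\<in>qS. g (slice_emb I z) = biquat_eval I (d z)"
  show "(f \<star> g) (slice_emb I z) = biquat_eval I (c z * d z)"
    using I f g biquat_eval_mult[OF I refl, of "c z" "d z"]
    by (simp add: star_def slice_emb_conjugate_unit conjugate_qS)
qed

lemma has_stem_const: "has_stem (\<lambda>_. q) (\<lambda>_. bq_of_quat q)"
  by (rule has_stemI) (auto simp: biquat_eval_bq_of_quat)

lemma has_stem_qJ: "has_stem \<J> (\<lambda>_. bscal \<i>)"
  by (rule has_stemI) (auto simp: D_upper biquat_eval_simps)

lemma has_stem_scal_mult: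
  assumes "has_stem \<alpha> (\<lambda>z. bscal (w z))" "has_stem f c"
  shows "has_stem (\<lambda>q. \<alpha> q * f q) (\<lambda>z. bscal (w z) * c z)"
  by (rule has_stem_map2[OF assms])
     (use assms in \<open>auto intro!: bq_meromorphic_intros(5)
        simp: has_stem_meromorphic biquat_eval_simps biquat_eval_scal_mult\<close>)

lemma has_stem_mult_quat:
  assumes "has_stem f c"
  shows "has_stem (\<lambda>q. f q * p) (\<lambda>z. c z * bq_of_quat p)"
  by (rule has_stem_map[OF assms])
     (use assms in \<open>auto intro!: bq_meromorphic_intros
        simp: has_stem_meromorphic biquat_eval_mult_quat\<close>)

lemma bscal_meromorphicD: "bq_meromorphic (\<lambda>z. bscal (w z)) A \<Longrightarrow> w meromorphic_on A"
  by (drule bq_meromorphicD(1)) simp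

lemma has_stem_inverse:
  assumes "has_stem \<alpha> (\<lambda>z. bscal (w z))"
  shows "has_stem (\<lambda>q. inverse (\<alpha> q)) (\<lambda>z. bscal (inverse (w z)))"
  by (rule has_stem_map[OF assms])
     (use bscal_meromorphicD[OF has_stem_meromorphic[OF assms]] in
       \<open>auto intro!: bq_meromorphic_intros meromorphic_intros simp: biquat_eval_simps slice_emb_inverse\<close>)

lemma qslice_eq: "qslice I = range (slice_emb I)"
proof -
  have "w = Complex (Re w) (Im w)" for w by simp
  then show ?thesis unfolding qslice_def slice_emb_of_real_eq by (auto, metis)
qed

text \<open>
  The plane \<open>\<complex>\<^sub>I\<close> contains the values at \<open>x + I y\<close> and at \<open>x - I y\<close>, hence both halves of the stem
  function.  Taking two different planes shows that these are real.
\<close>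

lemma slice_preserving_stem:
  assumes pres: "slice_preserving W f" and W: "circular W" and z: "Im z > 0" "z \<in> slice_coord ` W"
    and f: "\<And>I. I \<in> qS \<Longrightarrow> f (slice_emb I z) = biquat_eval I c"
  shows "c = bscal (bq0 c)"
proof -
  have mem: "biquat_eval I c \<in> qslice I" "biquat_eval (- I) c \<in> qslice I" if I: "I \<in> qS" for I
  proof -
    have "slice_emb I z \<in> W" "slice_emb (- I) z \<in> W"
      using slice_emb_mem_iff[OF W _ z(1)] I z(2) by simp_all
    then have "slice_emb I z \<in> W \<inter> qslice I" "slice_emb (- I) z \<in> W \<inter> qslice I"
      by (simp_all add: qslice_eq slice_emb_uminus_unit)
    moreover have "f ` (W \<inter> qslice I) \<subseteq> qslice I"
      using pres I by (simp add: slice_preserving_def)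
    ultimately have "f (slice_emb I z) \<in> qslice I" "f (slice_emb (- I) z) \<in> qslice I"
      by blast+
    then show "biquat_eval I c \<in> qslice I" "biquat_eval (- I) c \<in> qslice I"
      using f[OF I] f[of "- I"] I by simp_all
  qed
  from mem[of qi] have "qim2 (biquat_eval qi c) = 0" "qim3 (biquat_eval qi c) = 0"
    "qim2 (biquat_eval (- qi) c) = 0" "qim3 (biquat_eval (- qi) c) = 0"
    by (auto simp: qslice_def quat_mult_sel)
  moreover from mem[of qj] have "qim1 (biquat_eval qj c) = 0" "qim3 (biquat_eval qj c) = 0"
    "qim1 (biquat_eval (- qj) c) = 0" "qim3 (biquat_eval (- qj) c) = 0"
    by (auto simp: qslice_def quat_mult_sel qS_iff)
  ultimately show ?thesis
    by (simp add: biquat_eval_def slice_emb_def quat_mult_sel biquat_eq_iff complex_eq_iff)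
qed

lemma SEM_R_stem:
  assumes "\<alpha> \<in> SEM_R \<Omega>"
  obtains w where "w meromorphic_on D" "has_stem \<alpha> (\<lambda>z. bscal (w z))"
proof -
  obtain W where W: "regularity_domain \<Omega> \<alpha> W" "slice_preserving W \<alpha>"
    using assms by (auto simp: SEM_R_def)
  note st = regularity_domain_stem[OF W(1)]
  have reg: "slice_regular W \<alpha>" "circular W" using W(1) by (auto simp: regularity_domain_def)
  have "\<forall>\<^sub>\<approx>z\<in>D. stem \<alpha> z = bscal (bq0 (stem \<alpha> z))"
    using st(1) eventually_D
  proof eventually_elim
    case (elim z)
    have Im: "Im z > 0" using elim(2) by (rule D_upper)
    show ?case
      by (rule slice_preserving_stem[OF W(2) reg(2) Im elim(1)]) (rule stem_eval[OF reg Im elim(1)])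
  qed
  then have "has_stem \<alpha> (\<lambda>z. bscal (bq0 (stem \<alpha> z)))"
    by (rule has_stem_cong[OF st(2)])
  moreover from this have "(\<lambda>z. bq0 (stem \<alpha> z)) meromorphic_on D"
    by (intro bscal_meromorphicD has_stem_meromorphic)
  ultimately show ?thesis using that by blast
qed

lemma stem_SEM_R:
  assumes "has_stem \<alpha> (\<lambda>z. bscal (w z))"
  shows "\<alpha> \<in> SEM_R \<Omega>"
proof -
  obtain W where W: "regularity_domain \<Omega> \<alpha> W"
    and \<alpha>: "\<And>z I. z \<in> slice_coord ` W \<Longrightarrow> I \<in> qS \<Longrightarrow> \<alpha> (slice_emb I z) = biquat_eval I (bscal (w z))"
    using has_stem_regularity_domain[OF assms] by blast
  have "\<alpha> q \<in> qslice I" if I: "I \<in> qS" and q: "q \<in> W" "q \<in> qslice I" for I q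
  proof -
    obtain x y where xy: "q = slice_emb I (Complex x y)"
      using q(2) by (auto simp: qslice_def slice_emb_of_real_eq)
    define I' where "I' = (if y \<ge> 0 then I else - I)"
    have I': "I' \<in> qS" "q = slice_emb I' (slice_coord q)"
      using I by (auto simp: I'_def xy slice_coord_slice_emb slice_emb_uminus_unit complex_cnj)
    then have "\<alpha> q = slice_emb I' (w (slice_coord q))"
      using \<alpha>[of "slice_coord q" I'] q(1) by (simp add: biquat_eval_simps)
    also have "\<dots> = slice_emb I (if y \<ge> 0 then w (slice_coord q) else cnj (w (slice_coord q)))"
      by (simp add: I'_def slice_emb_uminus_unit)
    finally show ?thesis by (simp add: qslice_eq)
  qed
  then have "slice_preserving W \<alpha>"
    by (auto simp: slice_preserving_def)
  with W show ?thesis by (auto simp: SEM_R_def)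
qed

text \<open>
  The conjugate is given only through some choice of coordinates; since stem functions are unique
  up to a sparse set, any choice has the coordinates of \<open>c\<close>.
\<close>

lemma has_stem_conj:
  assumes f: "has_stem f c"
  shows "has_stem (sem_conj \<Omega> f) (\<lambda>z. bconj (c z))"
proof -
  let ?P = "\<lambda>g. \<exists>f0\<in>SEM_R \<Omega>. \<exists>f1\<in>SEM_R \<Omega>. \<exists>f2\<in>SEM_R \<Omega>. \<exists>f3\<in>SEM_R \<Omega>.
     f \<simeq>\<^bsub>\<Omega>\<^esub> (\<lambda>q. f0 q + (f1 q * qi + f2 q * qj + f3 q * qk)) \<and>
     g = (\<lambda>q. f0 q - (f1 q * qi + f2 q * qj + f3 q * qk))"
  have comb: "has_stem (\<lambda>q. f0 q + (f1 q * qi + f2 q * qj + f3 q * qk)) (\<lambda>z. BQ (w0 z) (w1 z) (w2 z) (w3 z))"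
    "has_stem (\<lambda>q. f0 q - (f1 q * qi + f2 q * qj + f3 q * qk)) (\<lambda>z. bconj (BQ (w0 z) (w1 z) (w2 z) (w3 z)))"
    if "has_stem f0 (\<lambda>z. bscal (w0 z))" "has_stem f1 (\<lambda>z. bscal (w1 z))"
      "has_stem f2 (\<lambda>z. bscal (w2 z))" "has_stem f3 (\<lambda>z. bscal (w3 z))" for f0 f1 f2 f3 w0 w1 w2 w3
  proof -
    have im: "has_stem (\<lambda>q. f1 q * qi + f2 q * qj + f3 q * qk)
       (\<lambda>z. bscal (w1 z) * bq_of_quat qi + bscal (w2 z) * bq_of_quat qj + bscal (w3 z) * bq_of_quat qk)"
      by (intro has_stem_add has_stem_mult_quat that)
    have "(\<lambda>z. bscal (w0 z) + (bscal (w1 z) * bq_of_quat qi + bscal (w2 z) * bq_of_quat qj + bscal (w3 z) * bq_of_quat qk))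
        = (\<lambda>z. BQ (w0 z) (w1 z) (w2 z) (w3 z))"
      "(\<lambda>z. bscal (w0 z) - (bscal (w1 z) * bq_of_quat qi + bscal (w2 z) * bq_of_quat qj + bscal (w3 z) * bq_of_quat qk))
        = (\<lambda>z. bconj (BQ (w0 z) (w1 z) (w2 z) (w3 z)))"
      by (simp_all add: fun_eq_iff biquat_eq_iff biquat_mult_sel)
    then show "has_stem (\<lambda>q. f0 q + (f1 q * qi + f2 q * qj + f3 q * qk)) (\<lambda>z. BQ (w0 z) (w1 z) (w2 z) (w3 z))"
      "has_stem (\<lambda>q. f0 q - (f1 q * qi + f2 q * qj + f3 q * qk)) (\<lambda>z. bconj (BQ (w0 z) (w1 z) (w2 z) (w3 z)))"
      using has_stem_add[OF that(1) im] has_stem_diff[OF that(1) im] by simp_all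
  qed
  define F where "F s = lift (\<lambda>z. bscal (s (c z)))" for s :: "biquat \<Rightarrow> complex"
  have F: "has_stem (F s) (\<lambda>z. bscal (s (c z)))" if "s \<in> bq_coords" for s
    unfolding F_def using has_stem_meromorphic[OF f] that
    by (intro has_stem_lift bq_meromorphic_intros) (simp add: bq_meromorphic_def)
  have coords: "bq0 \<in> bq_coords" "bq1 \<in> bq_coords" "bq2 \<in> bq_coords" "bq3 \<in> bq_coords"
    by (simp_all add: bq_coords_def)
  have "has_stem (\<lambda>q. F bq0 q + (F bq1 q * qi + F bq2 q * qj + F bq3 q * qk)) c"
    using comb(1)[OF F F F F, OF coords] by simp
  then have "f \<simeq>\<^bsub>\<Omega>\<^esub> (\<lambda>q. F bq0 q + (F bq1 q * qi + F bq2 q * qj + F bq3 q * qk))"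
    using f sem_eqI by blast
  moreover have "F bq0 \<in> SEM_R \<Omega>" "F bq1 \<in> SEM_R \<Omega>" "F bq2 \<in> SEM_R \<Omega>" "F bq3 \<in> SEM_R \<Omega>"
    using stem_SEM_R[OF F] coords by simp_all
  ultimately have "?P (\<lambda>q. F bq0 q - (F bq1 q * qi + F bq2 q * qj + F bq3 q * qk))"
    by (intro bexI[of _ "F bq0"] bexI[of _ "F bq1"] bexI[of _ "F bq2"] bexI[of _ "F bq3"] conjI refl)
  from someI[of ?P, OF this] have "?P (sem_conj \<Omega> f)"
    unfolding sem_conj_def .
  then obtain f0 f1 f2 f3 where R: "f0 \<in> SEM_R \<Omega>" "f1 \<in> SEM_R \<Omega>" "f2 \<in> SEM_R \<Omega>" "f3 \<in> SEM_R \<Omega>"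
    and fe: "f \<simeq>\<^bsub>\<Omega>\<^esub> (\<lambda>q. f0 q + (f1 q * qi + f2 q * qj + f3 q * qk))"
    and ce: "sem_conj \<Omega> f = (\<lambda>q. f0 q - (f1 q * qi + f2 q * qj + f3 q * qk))"
    by (elim bexE conjE)
  obtain w0 where w0: "has_stem f0 (\<lambda>z. bscal (w0 z))" using SEM_R_stem[OF R(1)] by blast
  obtain w1 where w1: "has_stem f1 (\<lambda>z. bscal (w1 z))" using SEM_R_stem[OF R(2)] by blast
  obtain w2 where w2: "has_stem f2 (\<lambda>z. bscal (w2 z))" using SEM_R_stem[OF R(3)] by blast
  obtain w3 where w3: "has_stem f3 (\<lambda>z. bscal (w3 z))" using SEM_R_stem[OF R(4)] by blast
  have "\<forall>\<^sub>\<approx>z\<in>D. c z = BQ (w0 z) (w1 z) (w2 z) (w3 z)"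
    using fe sem_eq_iff[OF f comb(1)[OF w0 w1 w2 w3]] by simp
  then have "\<forall>\<^sub>\<approx>z\<in>D. bconj (BQ (w0 z) (w1 z) (w2 z) (w3 z)) = bconj (c z)"
    by eventually_elim simp
  then show ?thesis
    unfolding ce by (rule has_stem_cong[OF comb(2)[OF w0 w1 w2 w3]])
qed

lemma has_stem_symm:
  assumes "has_stem f c"
  shows "has_stem (sem_symm \<Omega> f) (\<lambda>z. bscal (bnorm (c z)))"
  using has_stem_star[OF assms has_stem_conj[OF assms]] by (simp add: sem_symm_def biquat_mult_bconj)

lemma bq_of_quat_half:
  "bq_of_quat (inverse 2) = bscal (1/2)" "bq_of_quat (1/2) = bscal (1/2)"
  "bq_of_quat (- (1/2)) = bscal (- (1/2))"
proof -
  have two: "(2 :: quat) = 2 *\<^sub>R 1"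
    by (metis of_real_def of_real_numeral)
  have "2 * ((1/2) *\<^sub>R 1) = (1 :: quat)"
    unfolding two by simp
  then have inv: "inverse 2 = (1/2) *\<^sub>R (1 :: quat)"
    by (rule inverse_unique)
  have half: "1 / 2 = inverse (2 :: quat)"
    by (simp only: divide_inverse mult_1)
  show "bq_of_quat (inverse 2) = bscal (1/2)" "bq_of_quat (1/2) = bscal (1/2)"
    "bq_of_quat (- (1/2)) = bscal (- (1/2))"
    unfolding half inv by (simp_all add: biquat_eq_iff)
qed

lemma has_stem_re:
  assumes "has_stem f c"
  shows "has_stem (sem_re \<Omega> f) (\<lambda>z. bscal (bq0 (c z)))"
proof -
  have "has_stem (\<lambda>q. (f q + sem_conj \<Omega> f q) * inverse 2) (\<lambda>z. (c z + bconj (c z)) * bq_of_quat (inverse 2))"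
    by (intro has_stem_mult_quat has_stem_add has_stem_conj assms)
  moreover have "(c z + bconj (c z)) * bq_of_quat (inverse 2) = bscal (bq0 (c z))" for z
    by (simp add: bq_of_quat_half biquat_eq_iff biquat_mult_sel)
  ultimately show ?thesis
    unfolding sem_re_def divide_inverse by simp
qed

lemma has_stem_vec:
  assumes "has_stem f c"
  shows "has_stem (sem_vec \<Omega> f) (\<lambda>z. bvec (c z))"
proof -
  have "c z - bscal (bq0 (c z)) = bvec (c z)" for z
    by (simp add: biquat_eq_iff)
  then show ?thesis
    using has_stem_diff[OF assms has_stem_re[OF assms]] by (simp add: sem_vec_def)
qed

lemma has_stem_inv:
  assumes "has_stem f c"
  shows "has_stem (sem_inv \<Omega> f) (\<lambda>z. binv (c z))"
  unfolding sem_inv_def binv_def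
  by (intro has_stem_scal_mult has_stem_inverse has_stem_symm has_stem_conj assms)

lemma has_stem_inner:
  assumes "has_stem f c" "has_stem g d"
  shows "has_stem (sem_inner \<Omega> f g) (\<lambda>z. bscal (bdot (c z) (d z)))"
proof -
  have "bq0 (b * bconj b') = bdot b b'" for b b'
    by (simp add: biquat_mult_sel bdot_def)
  then show ?thesis
    using has_stem_re[OF has_stem_star[OF assms(1) has_stem_conj[OF assms(2)]]]
    by (simp add: sem_inner_def)
qed

lemma meromorphic_zero_or_nonzero:
  assumes "w meromorphic_on D"
  shows "(\<forall>\<^sub>\<approx>z\<in>D. w z = 0) \<or> (\<forall>\<^sub>\<approx>z\<in>D. w z \<noteq> 0)"
  using meromorphic_imp_constant_or_avoid[OF assms open_D connected_D] .

lemma eventually_False_D: "\<not> (\<forall>\<^sub>\<approx>z\<in>D. False)"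
  using D_nonempty by (simp add: trivial_limit_def[symmetric])

end

section \<open>The Sylvester operator on biquaternions\<close>

lemma binv_mult:
  assumes "bnorm c \<noteq> 0"
  shows "c * binv c = 1" "binv c * c = 1"
proof -
  have "c * binv c = bscal (inverse (bnorm c)) * (c * bconj c)"
    by (simp add: binv_def mult.assoc[symmetric] bscal_commute[of c])
  then show "c * binv c = 1"
    using assms by (simp add: biquat_mult_bconj bscal_simps(5) flip: bscal_simps(4))
  show "binv c * c = 1"
    using assms by (simp add: binv_def mult.assoc biquat_mult_bconj bscal_simps(5) flip: bscal_simps(4))
qed

lemma bnorm_bconj: "bnorm (bconj c) = bnorm c"
  by (simp add: bdot_def)

lemma bvec_square: "bvec c * bvec c = - bscal (bnorm (bvec c))"
  by (simp add: biquat_eq_iff biquat_mult_sel bdot_def)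

lemma biquat_decomp: "c = bscal (bq0 c) + bvec c"
  by (simp add: biquat_eq_iff)

text \<open>
  With \<open>L\<close> and \<open>R\<close> the multiplications by \<open>u\<close> on the left and by \<open>v\<close> on the right, which
  commute and have scalar squares \<open>-a\<close> and \<open>-b\<close>, the operator is \<open>1 + L + R\<close>.  Multiplying by
  \<open>1 + L - R\<close> removes \<open>R\<close>, then multiplying by \<open>1 - a + b - 2L\<close> removes \<open>L\<close>.
\<close>

lemma sylvester_eliminate:
  fixes u v c :: biquat
  assumes u: "u * u = - bscal a" and v: "v * v = - bscal b"
  defines "T \<equiv> \<lambda>c. c + u * c + c * v" and "P \<equiv> \<lambda>c. c + u * c - c * v"
    and "Q \<equiv> \<lambda>c. bscal (1 - a + b) * c - bscal 2 * (u * c)"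
  shows "Q (P (T c)) = bscal ((1 - a + b)\<^sup>2 + 4 * a) * c"
    and "T (P (Q c)) = bscal ((1 - a + b)\<^sup>2 + 4 * a) * c"
proof -
  have uu: "u * (u * x) = - (bscal a * x)" for x
    by (simp add: mult.assoc[symmetric] u)
  have vv: "x * v * v = - (bscal b * x)" for x
    by (simp add: mult.assoc v bscal_commute[of x])
  have two: "bscal 2 * x = x + x" for x
    by (simp add: biquat_eq_iff biquat_mult_sel)
  have PT: "P (T c) = bscal (1 - a + b) * c + bscal 2 * (u * c)"
    and TP: "T (P c) = bscal (1 - a + b) * c + bscal 2 * (u * c)" for c
    unfolding P_def T_def two
    by (simp_all add: bscal_simps distrib_left distrib_right left_diff_distrib right_diff_distrib uu vv mult.assoc[symmetric])
      (simp_all add: mult.assoc uu algebra_simps)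
  have ub: "u * (bscal w * x) = bscal w * (u * x)" for w x
    by (simp add: mult.assoc[symmetric] bscal_commute[of u])
  have s2: "bscal w * (bscal w' * x) = bscal (w * w') * x" for w w' x
    by (simp add: bscal_simps mult.assoc)
  have fin: "bscal (m * m) * c + bscal (4 * a) * c = bscal (m\<^sup>2 + 4 * a) * c" for m
    by (simp add: bscal_simps power2_eq_square distrib_right)
  have "bscal m * (bscal m * c + bscal 2 * (u * c)) - bscal 2 * (u * (bscal m * c + bscal 2 * (u * c)))
      = bscal (m * m) * c + bscal (4 * a) * c"
    "bscal m * (bscal m * c - bscal 2 * (u * c)) + bscal 2 * (u * (bscal m * c - bscal 2 * (u * c)))
      = bscal (m * m) * c + bscal (4 * a) * c" for m
  proof -
    have "u * (bscal m * c + bscal 2 * (u * c)) = bscal m * (u * c) - bscal (2 * a) * c"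
      "u * (bscal m * c - bscal 2 * (u * c)) = bscal m * (u * c) + bscal (2 * a) * c"
      by (simp_all add: distrib_left right_diff_distrib ub uu s2)
    moreover have "bscal m * (bscal m * c + bscal 2 * y) - bscal 2 * (bscal m * y - bscal (2 * a) * c)
      = bscal (m * m) * c + bscal (4 * a) * c"
      "bscal m * (bscal m * c - bscal 2 * y) + bscal 2 * (bscal m * y + bscal (2 * a) * c)
      = bscal (m * m) * c + bscal (4 * a) * c" for y
      by (simp_all add: biquat_eq_iff biquat_mult_sel algebra_simps)
    ultimately show "bscal m * (bscal m * c + bscal 2 * (u * c)) - bscal 2 * (u * (bscal m * c + bscal 2 * (u * c)))
      = bscal (m * m) * c + bscal (4 * a) * c"
    "bscal m * (bscal m * c - bscal 2 * (u * c)) + bscal 2 * (u * (bscal m * c - bscal 2 * (u * c)))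
      = bscal (m * m) * c + bscal (4 * a) * c" by simp_all
  qed
  then show "Q (P (T c)) = bscal ((1 - a + b)\<^sup>2 + 4 * a) * c"
    and "T (P (Q c)) = bscal ((1 - a + b)\<^sup>2 + 4 * a) * c"
    unfolding PT TP unfolding Q_def by (simp_all add: fin)
qed

text \<open>
  The stem function of \<open>\<J> s I\<close> at a point, for \<open>I = qi\<close>.
\<close>

definition axial :: "complex \<Rightarrow> biquat" where
  "axial s = bscal (\<i> * s) * bq_of_quat qi"

lemma axial_square: "axial s * axial s = bscal (s\<^sup>2)"
  by (simp add: axial_def biquat_eq_iff biquat_mult_sel power2_eq_square algebra_simps)

lemma trace_zero_square: "bq0 u = 0 \<Longrightarrow> u * u = - bscal (bnorm u)"
  using bvec_square[of u] by (simp add: biquat_eq_iff biquat_mult_sel bdot_def)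

text \<open>
  Since \<open>u\<close> and \<open>axial s\<close> have the same square, \<open>u c + c (axial s)\<close> intertwines them for every
  \<open>c\<close>.  For \<open>s \<noteq> 0\<close> the choices \<open>c = 1\<close> and \<open>c = qj\<close> cannot both give a zero divisor: their norms
  vanish for different values of \<open>u\<^sub>1\<close>.
\<close>

lemma intertwine:
  assumes "u * u = bscal (s\<^sup>2)"
  shows "u * (u * c + c * axial s) = (u * c + c * axial s) * axial s"
  using assms
  by (simp add: distrib_left distrib_right mult.assoc axial_square bscal_commute[of c] add.commute)
    (simp add: mult.assoc[symmetric])

lemma intertwiner_norm:
  assumes "bq0 u = 0" "bnorm u = - s\<^sup>2"
  shows "bnorm (u * 1 + 1 * axial s) = 2 * s * (\<i> * bq1 u - s)"
    and "bnorm (u * bq_of_quat qj + bq_of_quat qj * axial s) = - 2 * s * (\<i> * bq1 u + s)"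
proof -
  have i: "\<i> * (\<i> * x) = - x" for x by (simp add: mult.assoc[symmetric])
  have u: "bq1 u * bq1 u = - s * s - bq2 u * bq2 u - bq3 u * bq3 u"
    using assms by (simp add: bdot_def power2_eq_square algebra_simps)
  show "bnorm (u * 1 + 1 * axial s) = 2 * s * (\<i> * bq1 u - s)"
    "bnorm (u * bq_of_quat qj + bq_of_quat qj * axial s) = - 2 * s * (\<i> * bq1 u + s)"
    using assms(1) u by (simp_all add: axial_def bdot_def biquat_mult_sel algebra_simps i)
qed

text \<open>
  In the coordinates along \<open>1, I, J, K\<close> the operator splits into a block on \<open>1, I\<close> of
  determinant \<open>1 - 4\<tau>\<^sup>2\<close> and the block of rank one \<open>(x\<^sub>2 - \<i> x\<^sub>3, x\<^sub>3 + \<i> x\<^sub>2)\<close> on \<open>J, K\<close>.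
\<close>

lemma sylvester_normal_form:
  "x + axial (\<tau> + 1/2) * x + x * axial (\<tau> - 1/2) =
     BQ (bq0 x - 2 * \<i> * \<tau> * bq1 x) (bq1 x + 2 * \<i> * \<tau> * bq0 x) (bq2 x - \<i> * bq3 x) (bq3 x + \<i> * bq2 x)"
  by (simp add: axial_def biquat_eq_iff biquat_mult_sel algebra_simps)

lemma det_nonzero:
  fixes \<tau> :: complex
  assumes "\<tau> \<noteq> 1/2" "\<tau> \<noteq> - (1/2)"
  shows "1 - 4 * \<tau>\<^sup>2 \<noteq> 0"
proof
  assume "1 - 4 * \<tau>\<^sup>2 = 0"
  then have "\<tau>\<^sup>2 = (1/2)\<^sup>2" by (simp add: power2_eq_square mult.commute)
  then show False using assms power2_eq_iff by blast
qed

text \<open>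
  The constant stem functions of \<open>\<J> J + K\<close> and \<open>\<J> J - K\<close> for \<open>K = qi J\<close>.
\<close>

definition kernel_vector :: "quat \<Rightarrow> biquat" where "kernel_vector J = bscal \<i> * bq_of_quat J + bq_of_quat (qi * J)"
definition obstruction_vector :: "quat \<Rightarrow> biquat" where "obstruction_vector J = bscal \<i> * bq_of_quat J - bq_of_quat (qi * J)"

lemma orthogonal_unit:
  assumes "J \<in> qS" "inner qi J = 0"
  obtains p r where "J = Quat 0 0 p r" "p\<^sup>2 + r\<^sup>2 = 1"
proof
  show "J = Quat 0 0 (qim2 J) (qim3 J)" "(qim2 J)\<^sup>2 + (qim3 J)\<^sup>2 = 1"
    using assms by (auto simp: qS_iff inner_quat_def quat_eq_iff)
qed

text \<open>
  For \<open>J = p qj + r qk\<close> the kernel vector has the coordinates \<open>\<i>(p + \<i> r)\<close> and \<open>p + \<i> r\<close>, and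
  \<open>(p + \<i> r)(p - \<i> r) = 1\<close>; so the coefficient of a kernel element is its component along \<open>K\<close>.
\<close>

lemma normal_form_kernel:
  assumes J: "J \<in> qS" "inner qi J = 0" and \<tau>: "\<tau> \<noteq> 1/2" "\<tau> \<noteq> - (1/2)"
  shows "x + axial (\<tau> + 1/2) * x + x * axial (\<tau> - 1/2) = 0
    \<longleftrightarrow> x = bscal (bdot x (bq_of_quat (qi * J))) * kernel_vector J"
    (is "?L \<longleftrightarrow> ?R")
    and "bscal w * kernel_vector J + axial (\<tau> + 1/2) * (bscal w * kernel_vector J) + bscal w * kernel_vector J * axial (\<tau> - 1/2) = 0"
proof -
  obtain p r where J': "J = Quat 0 0 p r" and pr: "p\<^sup>2 + r\<^sup>2 = 1"
    using J by (rule orthogonal_unit)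
  have i: "\<i> * (\<i> * y) = - y" for y by (simp add: mult.assoc[symmetric])
  show ker: "bscal w * kernel_vector J + axial (\<tau> + 1/2) * (bscal w * kernel_vector J) + bscal w * kernel_vector J * axial (\<tau> - 1/2) = 0" for w
    unfolding sylvester_normal_form
    by (simp add: J' kernel_vector_def biquat_eq_iff biquat_mult_sel quat_mult_sel algebra_simps i)
  show "?L \<longleftrightarrow> ?R"
  proof
    assume ?R
    then show ?L using ker by metis
  next
    assume ?L
    then have "bq0 x - 2 * \<i> * \<tau> * bq1 x = 0" "bq1 x + 2 * \<i> * \<tau> * bq0 x = 0" "bq2 x - \<i> * bq3 x = 0"
      unfolding sylvester_normal_form by (simp_all only: biquat_eq_iff biquat.sel biquat_sel)
    then have x: "bq0 x = 2 * \<i> * \<tau> * bq1 x" "bq1 x = - (2 * \<i> * \<tau> * bq0 x)" "bq2 x = \<i> * bq3 x"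
      by (simp_all only: eq_iff_diff_eq_0[symmetric] eq_neg_iff_add_eq_0)
    have "(1 - 4 * \<tau>\<^sup>2) * bq1 x = 0"
      using x(2) unfolding x(1) by (simp add: algebra_simps power2_eq_square i)
    then have "bq1 x = 0" using det_nonzero[OF \<tau>] by simp
    with x(1) have "bq0 x = 0" by simp
    have prc: "of_real p * of_real p + of_real r * of_real r = (1 :: complex)"
      using pr by (simp add: power2_eq_square flip: of_real_mult of_real_add)
    have "(of_real p - \<i> * of_real r) * (of_real p + \<i> * of_real r) = 1"
      using prc by (simp add: algebra_simps i)
    moreover have "bdot x (bq_of_quat (qi * J)) = bq3 x * (of_real p - \<i> * of_real r)"
      using x(3) by (simp add: J' bdot_def quat_mult_sel algebra_simps)
    ultimately have "bdot x (bq_of_quat (qi * J)) * (of_real p + \<i> * of_real r) = bq3 x"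
      by (simp add: mult.assoc)
    then have "bq3 x = bdot x (bq_of_quat (qi * J)) * (of_real p + \<i> * of_real r)" by simp
    moreover from this x(3) have "bq2 x = bdot x (bq_of_quat (qi * J)) * (\<i> * (of_real p + \<i> * of_real r))"
      by (simp add: algebra_simps)
    ultimately show ?R
      using \<open>bq0 x = 0\<close> \<open>bq1 x = 0\<close>
      by (simp add: J' kernel_vector_def biquat_eq_iff biquat_mult_sel quat_mult_sel algebra_simps i)
  qed
qed

text \<open>
  Cramer's rule on the block \<open>1, I\<close>; on the block \<open>J, K\<close> the coordinate along \<open>qk\<close> is set to \<open>0\<close>,
  which is possible because a kernel element may be added.
\<close>

definition bsolve :: "complex \<Rightarrow> biquat \<Rightarrow> biquat" where
  "bsolve \<tau> b = BQ ((bq0 b + 2 * \<i> * \<tau> * bq1 b) / (1 - 4 * \<tau>\<^sup>2))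
     ((bq1 b - 2 * \<i> * \<tau> * bq0 b) / (1 - 4 * \<tau>\<^sup>2)) (bq2 b) 0"

lemma normal_form_image:
  assumes J: "J \<in> qS" "inner qi J = 0" and \<tau>: "\<tau> \<noteq> 1/2" "\<tau> \<noteq> - (1/2)"
  shows "bdot (x + axial (\<tau> + 1/2) * x + x * axial (\<tau> - 1/2)) (obstruction_vector J) = 0"
    and "bdot b (obstruction_vector J) = 0 \<Longrightarrow>
      bsolve \<tau> b + axial (\<tau> + 1/2) * bsolve \<tau> b + bsolve \<tau> b * axial (\<tau> - 1/2) = b"
proof -
  obtain p r where J': "J = Quat 0 0 p r" and pr: "p\<^sup>2 + r\<^sup>2 = 1"
    using J by (rule orthogonal_unit)
  have i: "\<i> * (\<i> * y) = - y" for y by (simp add: mult.assoc[symmetric])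
  have dot: "bdot b (obstruction_vector J) = (of_real p - \<i> * of_real r) * (\<i> * bq2 b - bq3 b)" for b
    by (simp add: J' bdot_def obstruction_vector_def biquat_mult_sel quat_mult_sel algebra_simps i)
  show "bdot (x + axial (\<tau> + 1/2) * x + x * axial (\<tau> - 1/2)) (obstruction_vector J) = 0"
    unfolding sylvester_normal_form dot by (simp add: algebra_simps i)
  have prc: "of_real p * of_real p + of_real r * of_real r = (1 :: complex)"
    using pr by (simp add: power2_eq_square flip: of_real_mult of_real_add)
  have "(of_real p - \<i> * of_real r) * (of_real p + \<i> * of_real r) = 1"
    using prc by (simp add: algebra_simps i)
  then have nz: "of_real p - \<i> * of_real r \<noteq> 0" by auto
  note det = det_nonzero[OF \<tau>]
  assume "bdot b (obstruction_vector J) = 0"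
  then have "\<i> * bq2 b - bq3 b = 0" using nz unfolding dot mult_eq_0_iff by blast
  then have b3: "bq3 b = \<i> * bq2 b" by simp
  have solve2: "(b0 + 2 * \<i> * \<tau> * b1) / (1 - 4 * \<tau>\<^sup>2) - 2 * \<i> * \<tau> * ((b1 - 2 * \<i> * \<tau> * b0) / (1 - 4 * \<tau>\<^sup>2)) = b0"
    "(b1 - 2 * \<i> * \<tau> * b0) / (1 - 4 * \<tau>\<^sup>2) + 2 * \<i> * \<tau> * ((b0 + 2 * \<i> * \<tau> * b1) / (1 - 4 * \<tau>\<^sup>2)) = b1" for b0 b1
    using det by (simp_all add: divide_simps) (simp_all add: algebra_simps power2_eq_square i)
  show "bsolve \<tau> b + axial (\<tau> + 1/2) * bsolve \<tau> b + bsolve \<tau> b * axial (\<tau> - 1/2) = b"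
    unfolding sylvester_normal_form bsolve_def biquat.sel solve2 by (simp add: b3 biquat_eq_iff)
qed

lemma bsolve_meromorphic:
  assumes "bq_meromorphic b A" "\<tau> meromorphic_on A"
  shows "bq_meromorphic (\<lambda>z. bsolve (\<tau> z) (b z)) A"
  by (rule bq_meromorphicI) (auto simp: bsolve_def intro!: meromorphic_intros assms)


lemma bconj_mult: "bconj (c * d) = bconj d * bconj c"
  by (simp add: biquat_eq_iff biquat_mult_sel algebra_simps)

lemma sylvester_trace_one:
  assumes "bq0 f + bq0 g = 1"
  shows "f * c + c * g = c + bvec f * c + c * bvec g"
proof -
  have "f * c + c * g = (bscal (bq0 f) + bvec f) * c + c * (bscal (bq0 g) + bvec g)"
    by (simp flip: biquat_decomp)
  also have "\<dots> = bscal (bq0 f + bq0 g) * c + bvec f * c + c * bvec g"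
    by (simp only: distrib_left distrib_right bscal_commute[of c] bscal_simps add_ac)
  finally show ?thesis using assms by (simp add: bscal_simps)
qed

text \<open>
  The scalar left after the elimination; for \<open>f\<^sub>0 + g\<^sub>0 = 1\<close> the operator on biquaternions is
  invertible where it is not zero.
\<close>

definition sylvester_disc :: "biquat \<Rightarrow> biquat \<Rightarrow> complex" where
  "sylvester_disc f g = (1 - bnorm (bvec f) + bnorm (bvec g))\<^sup>2 + 4 * bnorm (bvec f)"

definition sylvester_inverse :: "biquat \<Rightarrow> biquat \<Rightarrow> biquat \<Rightarrow> biquat" where
  "sylvester_inverse f g b =
    (let c = bscal (inverse (sylvester_disc f g)) * b;
         y = bscal (1 - bnorm (bvec f) + bnorm (bvec g)) * c - bscal 2 * (bvec f * c)
     in y + bvec f * y - y * bvec g)"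

lemma sylvester_biquat_inject:
  assumes tr: "bq0 f + bq0 g = 1" and disc: "sylvester_disc f g \<noteq> 0"
    and eq: "f * c + c * g = f * d + d * g"
  shows "c = d"
proof -
  define x where "x = c - d"
  have "f * x + x * g = 0"
    using eq by (simp add: x_def algebra_simps)
  then have "x + bvec f * x + x * bvec g = 0"
    by (simp add: sylvester_trace_one[OF tr])
  from sylvester_eliminate(1)[OF bvec_square[of f] bvec_square[of g], of x, unfolded this]
  have "bscal (sylvester_disc f g) * x = 0"
    by (simp add: sylvester_disc_def)
  with disc have "x = 0"
    by (simp add: biquat_eq_iff biquat_mult_sel)
  then show ?thesis by (simp add: x_def)
qed

lemma sylvester_biquat_surj:
  assumes tr: "bq0 f + bq0 g = 1" and disc: "sylvester_disc f g \<noteq> 0"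
  shows "f * sylvester_inverse f g b + sylvester_inverse f g b * g = b"
proof -
  define c where "c = bscal (inverse (sylvester_disc f g)) * b"
  have "f * sylvester_inverse f g b + sylvester_inverse f g b * g = bscal (sylvester_disc f g) * c"
    using sylvester_eliminate(2)[OF bvec_square[of f] bvec_square[of g], of c]
    by (simp add: sylvester_trace_one[OF tr] sylvester_inverse_def Let_def sylvester_disc_def[of f g, symmetric]
        flip: c_def)
  then show ?thesis
    using disc by (simp add: c_def biquat_eq_iff biquat_mult_sel)
qed

text \<open>
  The two relations let \<open>h\<^sup>-\<^sup>1\<close> move past \<open>u\<close> and \<open>h'\<^sup>-\<^sup>1\<close> past \<open>v\<close>, so the same change of variable in
  argument and value replaces \<open>u, v\<close> by \<open>e, e'\<close>.
\<close>

lemma sylvester_conjugate: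
  assumes h: "bnorm h \<noteq> 0" "u * h = h * e" and h': "bnorm h' \<noteq> 0" "h' * v = e' * h'"
  shows "binv h * (c + u * c + c * v) * binv h'
    = binv h * c * binv h' + e * (binv h * c * binv h') + binv h * c * binv h' * e'"
proof -
  have "binv h * u * h * binv h = binv h * h * e * binv h"
    by (simp only: mult.assoc h(2))
  then have 1: "binv h * u = e * binv h"
    using binv_mult[OF h(1)] by (simp add: mult.assoc)
  have "binv h' * (h' * v) * binv h' = binv h' * (e' * h') * binv h'"
    by (simp only: h'(2))
  then have 2: "v * binv h' = binv h' * e'"
    using binv_mult[OF h'(1)] by (simp add: mult.assoc flip: mult.assoc[of "binv h'" h'])
  have "binv h * (c + u * c + c * v) * binv h'
      = binv h * c * binv h' + (binv h * u) * c * binv h' + binv h * c * (v * binv h')"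
    by (simp add: distrib_left distrib_right mult.assoc)
  then show ?thesis
    by (simp add: 1 2 mult.assoc)
qed

lemma binv_sandwich:
  assumes "bnorm h \<noteq> 0" "bnorm h' \<noteq> 0"
  shows "binv h * c * binv h' = x \<longleftrightarrow> c = h * x * h'"
proof
  assume x: "binv h * c * binv h' = x"
  have "h * (binv h * c * binv h') * h' = (h * binv h) * c * (binv h' * h')"
    by (simp add: mult.assoc)
  then have "h * x * h' = (h * binv h) * c * (binv h' * h')"
    unfolding x .
  then show "c = h * x * h'" by (simp add: binv_mult assms)
next
  assume "c = h * x * h'"
  then have "binv h * c * binv h' = (binv h * h) * x * (h' * binv h')"
    by (simp only: mult.assoc)
  then show "binv h * c * binv h' = x" by (simp add: binv_mult assms)
qed

lemma bscal_left_commute: "c * (bscal w * d) = bscal w * (c * d)"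
  by (simp add: mult.assoc[symmetric] bscal_commute[of c])

section \<open>The Sylvester operator on semi-regular functions\<close>

context product_dom begin

lemma has_stem_zero: "has_stem (\<lambda>_. 0) (\<lambda>_. 0)" and has_stem_one: "has_stem (\<lambda>_. 1) (\<lambda>_. 1)"
proof -
  have "bq_of_quat 0 = 0" "bq_of_quat 1 = 1" by (simp_all add: biquat_eq_iff)
  then show "has_stem (\<lambda>_. 0) (\<lambda>_. 0)" "has_stem (\<lambda>_. 1) (\<lambda>_. 1)"
    using has_stem_const[of 0] has_stem_const[of 1] by simp_all
qed

lemma sem_invertible_stem:
  assumes h: "has_stem h H" and nz: "\<forall>\<^sub>\<approx>z\<in>D. bnorm (H z) \<noteq> 0"
  shows "sem_invertible \<Omega> h"
proof -
  note one = has_stem_one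
  have "\<forall>\<^sub>\<approx>z\<in>D. H z * binv (H z) = 1" "\<forall>\<^sub>\<approx>z\<in>D. binv (H z) * H z = 1"
    using nz by (eventually_elim, simp add: binv_mult)+
  then have "h \<star> sem_inv \<Omega> h \<simeq>\<^bsub>\<Omega>\<^esub> (\<lambda>_. 1)" "sem_inv \<Omega> h \<star> h \<simeq>\<^bsub>\<Omega>\<^esub> (\<lambda>_. 1)"
    using sem_eq_iff[OF has_stem_star[OF h has_stem_inv[OF h]] one]
      sem_eq_iff[OF has_stem_star[OF has_stem_inv[OF h] h] one] by blast+
  then show ?thesis
    unfolding sem_invertible_def using has_stem_in_SEM h has_stem_inv[OF h] by blast
qed

lemma has_stem_sylvester:
  assumes "has_stem f F" "has_stem g G" "has_stem \<phi> C"
  shows "has_stem (sylvester f g \<phi>) (\<lambda>z. F z * C z + C z * G z)"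
  unfolding sylvester_def by (intro has_stem_add has_stem_star assms)

lemma sylvester_isomorphism:
  assumes f: "has_stem f F" and g: "has_stem g G"
    and tr: "\<forall>\<^sub>\<approx>z\<in>D. bq0 (F z) + bq0 (G z) = 1"
    and disc: "\<forall>\<^sub>\<approx>z\<in>D. sylvester_disc (F z) (G z) \<noteq> 0"
  shows "sem_isomorphism \<Omega> (sylvester f g)"
proof -
  note syl = has_stem_sylvester[OF f g]
  have maps: "sylvester f g \<in> SEM \<Omega> \<rightarrow> SEM \<Omega>"
    using syl SEM_iff by blast
  have additive: "sylvester f g (\<lambda>q. \<phi> q + \<psi> q) \<simeq>\<^bsub>\<Omega>\<^esub> (\<lambda>q. sylvester f g \<phi> q + sylvester f g \<psi> q)"
    if "\<phi> \<in> SEM \<Omega>" "\<psi> \<in> SEM \<Omega>" for \<phi> \<psi>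
  proof -
    obtain C E where C: "has_stem \<phi> C" and E: "has_stem \<psi> E" using \<open>\<phi> \<in> SEM \<Omega>\<close> \<open>\<psi> \<in> SEM \<Omega>\<close> SEM_iff by blast
    show ?thesis
      unfolding sem_eq_iff[OF syl[OF has_stem_add[OF C E]] has_stem_add[OF syl[OF C] syl[OF E]]]
      by (intro always_eventually allI) (simp add: algebra_simps)
  qed
  have homogeneous: "sylvester f g (\<alpha> \<star> \<phi>) \<simeq>\<^bsub>\<Omega>\<^esub> \<alpha> \<star> sylvester f g \<phi>"
    if "\<alpha> \<in> SEM_R \<Omega>" "\<phi> \<in> SEM \<Omega>" for \<alpha> \<phi>
  proof -
    obtain C where C: "has_stem \<phi> C" using \<open>\<phi> \<in> SEM \<Omega>\<close> SEM_iff by blast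
    obtain w where w: "has_stem \<alpha> (\<lambda>z. bscal (w z))" using \<open>\<alpha> \<in> SEM_R \<Omega>\<close> SEM_R_stem by blast
    show ?thesis
      unfolding sem_eq_iff[OF syl[OF has_stem_star[OF w C]] has_stem_star[OF w syl[OF C]]]
      by (intro always_eventually allI) (simp add: distrib_left bscal_left_commute mult.assoc)
  qed
  have injective: "sylvester f g \<phi> \<simeq>\<^bsub>\<Omega>\<^esub> sylvester f g \<psi> \<longleftrightarrow> \<phi> \<simeq>\<^bsub>\<Omega>\<^esub> \<psi>"
    if "\<phi> \<in> SEM \<Omega>" "\<psi> \<in> SEM \<Omega>" for \<phi> \<psi>
  proof -
    obtain C E where C: "has_stem \<phi> C" and E: "has_stem \<psi> E" using \<open>\<phi> \<in> SEM \<Omega>\<close> \<open>\<psi> \<in> SEM \<Omega>\<close> SEM_iff by blast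
    show ?thesis
      unfolding sem_eq_iff[OF syl[OF C] syl[OF E]] sem_eq_iff[OF C E]
    proof
      assume "\<forall>\<^sub>\<approx>z\<in>D. F z * C z + C z * G z = F z * E z + E z * G z"
      with tr disc show "\<forall>\<^sub>\<approx>z\<in>D. C z = E z"
        by eventually_elim (rule sylvester_biquat_inject)
    qed (auto elim: eventually_mono)
  qed
  have surjective: "\<exists>\<phi>\<in>SEM \<Omega>. sylvester f g \<phi> \<simeq>\<^bsub>\<Omega>\<^esub> \<psi>" if "\<psi> \<in> SEM \<Omega>" for \<psi>
  proof -
    obtain B where B: "has_stem \<psi> B" using \<open>\<psi> \<in> SEM \<Omega>\<close> unfolding SEM_iff by blast
    define C where "C z = sylvester_inverse (F z) (G z) (B z)" for z
    have "bq_meromorphic C D"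
      unfolding C_def sylvester_inverse_def sylvester_disc_def Let_def
      by (intro bq_meromorphic_intros meromorphic_intros has_stem_meromorphic[OF f]
          has_stem_meromorphic[OF g] has_stem_meromorphic[OF B])
    then have C: "has_stem (lift C) C" by (rule has_stem_lift)
    have "\<forall>\<^sub>\<approx>z\<in>D. F z * C z + C z * G z = B z"
      using tr disc unfolding C_def by eventually_elim (rule sylvester_biquat_surj)
    then have "sylvester f g (lift C) \<simeq>\<^bsub>\<Omega>\<^esub> \<psi>"
      using sem_eq_iff[OF syl[OF C] B] by blast
    then show ?thesis using has_stem_in_SEM[OF C] by blast
  qed
  show ?thesis
    unfolding sem_isomorphism_def
    by (intro conjI ballI maps additive homogeneous injective surjective)
qed

text \<open>
  The norm of the candidate for \<open>c = 1\<close> is meromorphic, so it is nonzero almost everywhere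
  unless it vanishes almost everywhere; in the latter case \<open>\<i> u\<^sub>1 = s\<close>, and the candidate for \<open>c = qj\<close>
  has norm \<open>-4 s\<^sup>2\<close>.
\<close>

lemma intertwiner_exists:
  assumes U: "bq_meromorphic U D" and s: "s meromorphic_on D"
    and props: "\<forall>\<^sub>\<approx>z\<in>D. bq0 (U z) = 0 \<and> bnorm (U z) = - (s z)\<^sup>2 \<and> s z \<noteq> 0"
  obtains H where "bq_meromorphic H D" "\<forall>\<^sub>\<approx>z\<in>D. bnorm (H z) \<noteq> 0 \<and> U z * H z = H z * axial (s z)"
proof -
  define H where "H c z = U z * c + c * axial (s z)" for c z
  have mero: "bq_meromorphic (H c) D" for c
    unfolding H_def axial_def by (intro bq_meromorphic_intros meromorphic_intros U s)
  have tw: "\<forall>\<^sub>\<approx>z\<in>D. U z * H c z = H c z * axial (s z)" for c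
    using props unfolding H_def
    by eventually_elim (rule intertwine, simp add: trace_zero_square bscal_simps)
  have "(\<lambda>z. \<i> * bq1 (U z) - s z) meromorphic_on D"
    by (intro meromorphic_intros U s)
  then consider "\<forall>\<^sub>\<approx>z\<in>D. \<i> * bq1 (U z) - s z = 0" | "\<forall>\<^sub>\<approx>z\<in>D. \<i> * bq1 (U z) - s z \<noteq> 0"
    using meromorphic_zero_or_nonzero by blast
  then show ?thesis
  proof cases
    case 1
    with props tw[of "bq_of_quat qj"]
    have "\<forall>\<^sub>\<approx>z\<in>D. bnorm (H (bq_of_quat qj) z) \<noteq> 0 \<and> U z * H (bq_of_quat qj) z = H (bq_of_quat qj) z * axial (s z)"
      by eventually_elim (simp add: H_def intertwiner_norm(2))
    with mero that show ?thesis by blast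
  next
    case 2
    with props tw[of 1]
    have "\<forall>\<^sub>\<approx>z\<in>D. bnorm (H 1 z) \<noteq> 0 \<and> U z * H 1 z = H 1 z * axial (s z)"
    proof eventually_elim
      case (elim z)
      then show ?case using intertwiner_norm(1)[of "U z" "s z"] by (simp add: H_def)
    qed
    with mero that show ?thesis by blast
  qed
qed

end

theorem proposition9p2:
  fixes \<Omega> :: "quat set" and f g :: "quat \<Rightarrow> quat"
  assumes "product_domain \<Omega>"
    and "f \<in> SEM \<Omega>" and "g \<in> SEM \<Omega>"
    and "(\<lambda>q. sem_re \<Omega> f q + sem_re \<Omega> g q) \<simeq>\<^bsub>\<Omega>\<^esub> (\<lambda>_. 1)"
    and "\<not> sem_isomorphism \<Omega> (sylvester f g)"
    and "\<not> sem_symm \<Omega> (sem_vec \<Omega> f) \<star> sem_symm \<Omega> (sem_vec \<Omega> g) \<simeq>\<^bsub>\<Omega>\<^esub> (\<lambda>_. 0)"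
  shows "\<exists>h h' \<tau> I.
    sem_invertible \<Omega> h \<and> sem_invertible \<Omega> h' \<and>
    \<tau> \<in> SEM_R \<Omega> \<and> \<not> \<tau> \<simeq>\<^bsub>\<Omega>\<^esub> (\<lambda>_. 1/2) \<and> \<not> \<tau> \<simeq>\<^bsub>\<Omega>\<^esub> (\<lambda>_. - (1/2)) \<and> I \<in> qS \<and>
    sem_inv \<Omega> h \<star> sem_vec \<Omega> f \<star> h \<simeq>\<^bsub>\<Omega>\<^esub> (\<lambda>q. \<J> q * (\<tau> q + 1/2) * I) \<and>
    h' \<star> sem_vec \<Omega> g \<star> sem_inv \<Omega> h' \<simeq>\<^bsub>\<Omega>\<^esub> (\<lambda>q. \<J> q * (\<tau> q - 1/2) * I) \<and>
    (\<forall>J\<in>qS. \<forall>K. inner I J = 0 \<and> K = I * J \<longrightarrow>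
       sem_kernel \<Omega> (sylvester f g) =
         {\<phi> \<in> SEM \<Omega>. \<exists>\<alpha>\<in>SEM_R \<Omega>. \<phi> \<simeq>\<^bsub>\<Omega>\<^esub> \<alpha> \<star> h \<star> (\<lambda>q. \<J> q * J + K) \<star> h'} \<and>
       (\<forall>\<bb>\<in>SEM \<Omega>.
          (\<exists>\<phi>\<in>SEM \<Omega>. sylvester f g \<phi> \<simeq>\<^bsub>\<Omega>\<^esub> \<bb>) \<longleftrightarrow>
          sem_inner \<Omega> (sem_inv \<Omega> h \<star> \<bb> \<star> sem_inv \<Omega> h') (\<lambda>q. \<J> q * J - K) \<simeq>\<^bsub>\<Omega>\<^esub> (\<lambda>_. 0)))"
proof -
  interpret product_dom \<Omega> by standard fact
  obtain F G where f: "has_stem f F" and g: "has_stem g G"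
    using assms(2,3) SEM_iff by blast
  note F = has_stem_meromorphic[OF f] and G = has_stem_meromorphic[OF g]
  define u where "u z = bvec (F z)" for z
  define v where "v z = bvec (G z)" for z
  define a where "a z = bnorm (u z)" for z
  define b where "b z = bnorm (v z)" for z
  have u: "has_stem (sem_vec \<Omega> f) u" and v: "has_stem (sem_vec \<Omega> g) v"
    unfolding u_def v_def by (intro has_stem_vec f g)+
  have um: "bq_meromorphic u D" and vm: "bq_meromorphic v D"
    using has_stem_meromorphic u v by blast+
  have am: "a meromorphic_on D" and bm: "b meromorphic_on D"
    unfolding a_def b_def by (intro meromorphic_intros um vm)+
  note zero = has_stem_zero and one = has_stem_one
  have "\<forall>\<^sub>\<approx>z\<in>D. bscal (bq0 (F z)) + bscal (bq0 (G z)) = 1"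
    using assms(4) sem_eq_iff[OF has_stem_add[OF has_stem_re[OF f] has_stem_re[OF g]] one] by blast
  then have tr: "\<forall>\<^sub>\<approx>z\<in>D. bq0 (F z) + bq0 (G z) = 1"
    by eventually_elim (simp add: biquat_eq_iff)
  have "(\<lambda>z. sylvester_disc (F z) (G z)) meromorphic_on D"
    unfolding sylvester_disc_def u_def[symmetric] v_def[symmetric] by (intro meromorphic_intros um vm)
  then have disc: "\<forall>\<^sub>\<approx>z\<in>D. sylvester_disc (F z) (G z) = 0"
    using meromorphic_zero_or_nonzero sylvester_isomorphism[OF f g tr] assms(5) by blast
  have "\<not> (\<forall>\<^sub>\<approx>z\<in>D. a z * b z = 0)"
  proof
    assume "\<forall>\<^sub>\<approx>z\<in>D. a z * b z = 0"
    then have "\<forall>\<^sub>\<approx>z\<in>D. bscal (bnorm (u z)) * bscal (bnorm (v z)) = 0"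
      by eventually_elim (auto simp: a_def b_def bscal_simps(6))
    then show False
      using assms(6) sem_eq_iff[OF has_stem_star[OF has_stem_symm[OF u] has_stem_symm[OF v]] zero] by blast
  qed
  then have ab: "\<forall>\<^sub>\<approx>z\<in>D. a z * b z \<noteq> 0"
    using meromorphic_zero_or_nonzero[of "\<lambda>z. a z * b z"] am bm by (auto intro: meromorphic_intros)
  \<comment> \<open>Solving \<open>-a = ((1 - a + b)/2)\<^sup>2\<close> for \<open>\<tau> + 1/2 = (1 - a + b)/2\<close>.\<close>
  define t where "t z = (b z - a z) / 2" for z
  have tm: "t meromorphic_on D" unfolding t_def by (intro meromorphic_intros am bm)
  have squares: "\<forall>\<^sub>\<approx>z\<in>D. a z = - (t z + 1/2)\<^sup>2 \<and> b z = - (t z - 1/2)\<^sup>2"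
    using disc
  proof eventually_elim
    case (elim z)
    have b: "b z = a z + 2 * t z" by (simp add: t_def field_simps)
    have "sylvester_disc (F z) (G z) = (1 - a z + b z)\<^sup>2 + 4 * a z"
      by (simp add: sylvester_disc_def a_def b_def u_def v_def)
    then have "4 * (a z + (t z + 1/2)\<^sup>2) = 0" "4 * (b z + (t z - 1/2)\<^sup>2) = 0"
      using elim unfolding b by (simp_all add: power2_eq_square algebra_simps)
    then have "a z + (t z + 1/2)\<^sup>2 = 0" "b z + (t z - 1/2)\<^sup>2 = 0"
      unfolding mult_eq_0_iff by auto
    then show ?case by (simp add: eq_neg_iff_add_eq_0)
  qed
  have pu: "\<forall>\<^sub>\<approx>z\<in>D. bq0 (u z) = 0 \<and> bnorm (u z) = - (t z + 1/2)\<^sup>2 \<and> t z + 1/2 \<noteq> 0"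
    and pv: "\<forall>\<^sub>\<approx>z\<in>D. bq0 (v z) = 0 \<and> bnorm (v z) = - (t z - 1/2)\<^sup>2 \<and> t z - 1/2 \<noteq> 0"
    using squares ab by (eventually_elim, auto simp: u_def v_def a_def b_def)+
  have sm: "(\<lambda>z. t z + 1/2) meromorphic_on D" "(\<lambda>z. t z - 1/2) meromorphic_on D"
    by (intro meromorphic_intros tm)+
  obtain H where Hm: "bq_meromorphic H D"
    and H: "\<forall>\<^sub>\<approx>z\<in>D. bnorm (H z) \<noteq> 0 \<and> u z * H z = H z * axial (t z + 1/2)"
    using intertwiner_exists[OF um sm(1) pu] by blast
  obtain L where Lm: "bq_meromorphic L D"
    and L: "\<forall>\<^sub>\<approx>z\<in>D. bnorm (L z) \<noteq> 0 \<and> v z * L z = L z * axial (t z - 1/2)"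
    using intertwiner_exists[OF vm sm(2) pv] by blast
  \<comment> \<open>Conjugation reverses products and negates vectorial elements, so it turns \<open>v L = L e\<close> into
    \<open>L\<^sup>c v = e L\<^sup>c\<close>.\<close>
  define H' where "H' z = bconj (L z)" for z
  have H'm: "bq_meromorphic H' D" unfolding H'_def using Lm by (rule bq_meromorphic_intros)
  have H': "\<forall>\<^sub>\<approx>z\<in>D. bnorm (H' z) \<noteq> 0 \<and> H' z * v z = axial (t z - 1/2) * H' z"
    using L
  proof eventually_elim
    case (elim z)
    have "bconj (L z) * bconj (v z) = bconj (axial (t z - 1/2)) * bconj (L z)"
      using elim by (simp flip: bconj_mult)
    moreover have "bconj (v z) = - v z" "bconj (axial w) = - axial w" for w
      by (simp_all add: v_def axial_def biquat_eq_iff biquat_mult_sel)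
    ultimately show ?case using elim by (simp add: H'_def bnorm_bconj)
  qed
  define h where "h = lift H"
  define h' where "h' = lift H'"
  define \<tau> where "\<tau> = lift (\<lambda>z. bscal (t z))"
  have h: "has_stem h H" and h': "has_stem h' H'" and \<tau>: "has_stem \<tau> (\<lambda>z. bscal (t z))"
    unfolding h_def h'_def \<tau>_def by (intro has_stem_lift Hm H'm bq_meromorphic_intros tm)+
  have inv: "sem_invertible \<Omega> h" "sem_invertible \<Omega> h'"
    using H H' by (auto intro!: sem_invertible_stem[OF h] sem_invertible_stem[OF h'] elim: eventually_mono)
  have \<tau>R: "\<tau> \<in> SEM_R \<Omega>" using \<tau> by (rule stem_SEM_R)
  have \<tau>ne: "\<forall>\<^sub>\<approx>z\<in>D. t z \<noteq> 1/2 \<and> t z \<noteq> - (1/2)"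
    using pu pv by eventually_elim auto
  have "\<not> \<tau> \<simeq>\<^bsub>\<Omega>\<^esub> (\<lambda>_. 1/2)" "\<not> \<tau> \<simeq>\<^bsub>\<Omega>\<^esub> (\<lambda>_. - (1/2))"
  proof -
    have "\<not> (\<forall>\<^sub>\<approx>z\<in>D. bscal (t z) = bscal w)" if "w = 1/2 \<or> w = - (1/2)" for w
    proof
      assume "\<forall>\<^sub>\<approx>z\<in>D. bscal (t z) = bscal w"
      with \<tau>ne have "\<forall>\<^sub>\<approx>z\<in>D. False"
        by eventually_elim (use that in \<open>auto simp: biquat_eq_iff\<close>)
      with eventually_False_D show False by blast
    qed
    then show "\<not> \<tau> \<simeq>\<^bsub>\<Omega>\<^esub> (\<lambda>_. 1/2)" "\<not> \<tau> \<simeq>\<^bsub>\<Omega>\<^esub> (\<lambda>_. - (1/2))"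
      using sem_eq_iff[OF \<tau> has_stem_const[of "1/2"]] sem_eq_iff[OF \<tau> has_stem_const[of "- (1/2)"]]
      unfolding bq_of_quat_half by blast+
  qed
  moreover have "sem_inv \<Omega> h \<star> sem_vec \<Omega> f \<star> h \<simeq>\<^bsub>\<Omega>\<^esub> (\<lambda>q. \<J> q * (\<tau> q + 1/2) * qi)"
  proof -
    have st: "has_stem (\<lambda>q. \<J> q * (\<tau> q + 1/2) * qi) (\<lambda>z. bscal \<i> * (bscal (t z) + bq_of_quat (1/2)) * bq_of_quat qi)"
      by (intro has_stem_mult_quat has_stem_scal_mult has_stem_qJ has_stem_add \<tau> has_stem_const)
    show ?thesis
      unfolding sem_eq_iff[OF has_stem_star[OF has_stem_star[OF has_stem_inv[OF h] u] h] st]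
      using H
    proof eventually_elim
      case (elim z)
      then have "binv (H z) * u z * H z = binv (H z) * H z * axial (t z + 1/2)" by (simp add: mult.assoc)
      also have "\<dots> = bscal \<i> * (bscal (t z) + bq_of_quat (1/2)) * bq_of_quat qi"
        using elim by (simp add: binv_mult axial_def bq_of_quat_half flip: bscal_simps(1,2,4))
      finally show ?case .
    qed
  qed
  moreover have "h' \<star> sem_vec \<Omega> g \<star> sem_inv \<Omega> h' \<simeq>\<^bsub>\<Omega>\<^esub> (\<lambda>q. \<J> q * (\<tau> q - 1/2) * qi)"
  proof -
    have st: "has_stem (\<lambda>q. \<J> q * (\<tau> q - 1/2) * qi) (\<lambda>z. bscal \<i> * (bscal (t z) - bq_of_quat (1/2)) * bq_of_quat qi)"
      by (intro has_stem_mult_quat has_stem_scal_mult has_stem_qJ has_stem_diff \<tau> has_stem_const)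
    show ?thesis
      unfolding sem_eq_iff[OF has_stem_star[OF has_stem_star[OF h' v] has_stem_inv[OF h']] st]
      using H'
    proof eventually_elim
      case (elim z)
      then have "H' z * v z * binv (H' z) = axial (t z - 1/2) * (H' z * binv (H' z))" by (simp add: mult.assoc)
      also have "\<dots> = bscal \<i> * (bscal (t z) - bq_of_quat (1/2)) * bq_of_quat qi"
        using elim by (simp add: binv_mult axial_def bq_of_quat_half flip: bscal_simps(1,2,4))
      finally show ?case .
    qed
  qed
  moreover have "sem_kernel \<Omega> (sylvester f g) =
         {\<phi> \<in> SEM \<Omega>. \<exists>\<alpha>\<in>SEM_R \<Omega>. \<phi> \<simeq>\<^bsub>\<Omega>\<^esub> \<alpha> \<star> h \<star> (\<lambda>q. \<J> q * J + K) \<star> h'}"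
    and "\<And>\<bb>. \<bb> \<in> SEM \<Omega> \<Longrightarrow> (\<exists>\<phi>\<in>SEM \<Omega>. sylvester f g \<phi> \<simeq>\<^bsub>\<Omega>\<^esub> \<bb>) \<longleftrightarrow>
          sem_inner \<Omega> (sem_inv \<Omega> h \<star> \<bb> \<star> sem_inv \<Omega> h') (\<lambda>q. \<J> q * J - K) \<simeq>\<^bsub>\<Omega>\<^esub> (\<lambda>_. 0)"
    if J: "J \<in> qS" "inner qi J = 0" and K: "K = qi * J" for J K
  proof -
    note syl = has_stem_sylvester[OF f g]
    have plus: "has_stem (\<lambda>q. \<J> q * J + K) (\<lambda>_. kernel_vector J)" and minus: "has_stem (\<lambda>q. \<J> q * J - K) (\<lambda>_. obstruction_vector J)"
      unfolding kernel_vector_def obstruction_vector_def K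
      by (intro has_stem_add has_stem_diff has_stem_mult_quat has_stem_qJ has_stem_const)+
    \<comment> \<open>In the coordinate \<open>X C = h\<^sup>-\<^sup>1 C h'\<^sup>-\<^sup>1\<close> the operator becomes the normal form \<open>N\<close>.\<close>
    define X where "X C z = binv (H z) * C z * binv (H' z)" for C z
    define N where "N w x = x + axial (w + 1/2) * x + x * axial (w - 1/2)" for w x
    have Xm: "bq_meromorphic (X C) D" if "has_stem \<phi> C" for \<phi> C
      using has_stem_meromorphic[OF has_stem_star[OF has_stem_star[OF has_stem_inv[OF h] that] has_stem_inv[OF h']]]
      unfolding X_def .
    have normal: "\<forall>\<^sub>\<approx>z\<in>D. binv (H z) * (F z * C z + C z * G z) * binv (H' z) = N (t z) (X C z)" for C
      using H H' tr
    proof eventually_elim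
      case (elim z)
      then show ?case
        using sylvester_conjugate[of "H z" "u z" _ "H' z" "v z" _ "C z"]
        by (simp add: sylvester_trace_one X_def N_def u_def v_def)
    qed
    have sandwich: "\<forall>\<^sub>\<approx>z\<in>D. \<forall>c x. binv (H z) * c * binv (H' z) = x \<longleftrightarrow> c = H z * x * H' z"
      using H H' by eventually_elim (simp add: binv_sandwich)
    have kernel: "sylvester f g \<phi> \<simeq>\<^bsub>\<Omega>\<^esub> (\<lambda>_. 0) \<longleftrightarrow>
        (\<exists>\<alpha>\<in>SEM_R \<Omega>. \<phi> \<simeq>\<^bsub>\<Omega>\<^esub> \<alpha> \<star> h \<star> (\<lambda>q. \<J> q * J + K) \<star> h')" if "\<phi> \<in> SEM \<Omega>" for \<phi>
    proof -
      obtain C where C: "has_stem \<phi> C" using \<open>\<phi> \<in> SEM \<Omega>\<close> unfolding SEM_iff by blast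
      have stem_rhs: "has_stem (\<alpha> \<star> h \<star> (\<lambda>q. \<J> q * J + K) \<star> h') (\<lambda>z. bscal (w z) * H z * kernel_vector J * H' z)"
        if "has_stem \<alpha> (\<lambda>z. bscal (w z))" for \<alpha> w
        by (intro has_stem_star that h h' plus)
      have swap: "bscal w * p * q * r = p * (bscal w * q) * r" for w p q r
        by (simp add: mult.assoc bscal_left_commute)
      show ?thesis
      proof
        assume "sylvester f g \<phi> \<simeq>\<^bsub>\<Omega>\<^esub> (\<lambda>_. 0)"
        then have "\<forall>\<^sub>\<approx>z\<in>D. F z * C z + C z * G z = 0"
          using sem_eq_iff[OF syl[OF C] zero] by blast
        define w where "w z = bdot (X C z) (bq_of_quat K)" for z
        have \<alpha>: "has_stem (lift (\<lambda>z. bscal (w z))) (\<lambda>z. bscal (w z))"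
          unfolding w_def by (intro has_stem_lift bq_meromorphic_intros meromorphic_intros Xm[OF C])
        have "\<forall>\<^sub>\<approx>z\<in>D. C z = bscal (w z) * H z * kernel_vector J * H' z"
          using \<open>\<forall>\<^sub>\<approx>z\<in>D. F z * C z + C z * G z = 0\<close> normal[of C] sandwich \<tau>ne
        proof eventually_elim
          case (elim z)
          have "N (t z) (X C z) = 0" using elim(1,2) by simp
          then have "X C z = bscal (w z) * kernel_vector J"
            using normal_form_kernel(1)[OF J, of "t z" "X C z"] elim(4) unfolding N_def w_def K by blast
          then show ?case using elim(3) unfolding X_def swap by blast
        qed
        then have "\<phi> \<simeq>\<^bsub>\<Omega>\<^esub> lift (\<lambda>z. bscal (w z)) \<star> h \<star> (\<lambda>q. \<J> q * J + K) \<star> h'"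
          using sem_eq_iff[OF C stem_rhs[OF \<alpha>]] by blast
        then show "\<exists>\<alpha>\<in>SEM_R \<Omega>. \<phi> \<simeq>\<^bsub>\<Omega>\<^esub> \<alpha> \<star> h \<star> (\<lambda>q. \<J> q * J + K) \<star> h'"
          using stem_SEM_R[OF \<alpha>] by blast
      next
        assume "\<exists>\<alpha>\<in>SEM_R \<Omega>. \<phi> \<simeq>\<^bsub>\<Omega>\<^esub> \<alpha> \<star> h \<star> (\<lambda>q. \<J> q * J + K) \<star> h'"
        then obtain \<alpha> where "\<alpha> \<in> SEM_R \<Omega>" and eq: "\<phi> \<simeq>\<^bsub>\<Omega>\<^esub> \<alpha> \<star> h \<star> (\<lambda>q. \<J> q * J + K) \<star> h'" by blast
        then obtain w where w: "has_stem \<alpha> (\<lambda>z. bscal (w z))" using SEM_R_stem by blast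
        have "\<forall>\<^sub>\<approx>z\<in>D. C z = bscal (w z) * H z * kernel_vector J * H' z"
          using eq sem_eq_iff[OF C stem_rhs[OF w]] by blast
        then have "\<forall>\<^sub>\<approx>z\<in>D. F z * C z + C z * G z = 0"
          using normal[of C] sandwich \<tau>ne
        proof eventually_elim
          case (elim z)
          have "X C z = bscal (w z) * kernel_vector J"
            using elim(1,3) unfolding X_def swap by blast
          then have "N (t z) (X C z) = 0"
            using normal_form_kernel(2)[OF J, of "t z" "w z"] elim(4) unfolding N_def by simp
          then have "binv (H z) * (F z * C z + C z * G z) * binv (H' z) = 0" using elim(2) by simp
          then have "F z * C z + C z * G z = H z * 0 * H' z" using elim(3) by blast
          then show ?case by simp
        qed
        then show "sylvester f g \<phi> \<simeq>\<^bsub>\<Omega>\<^esub> (\<lambda>_. 0)"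
          using sem_eq_iff[OF syl[OF C] zero] by blast
      qed
    qed
    show "sem_kernel \<Omega> (sylvester f g) =
         {\<phi> \<in> SEM \<Omega>. \<exists>\<alpha>\<in>SEM_R \<Omega>. \<phi> \<simeq>\<^bsub>\<Omega>\<^esub> \<alpha> \<star> h \<star> (\<lambda>q. \<J> q * J + K) \<star> h'}"
      unfolding sem_kernel_def using kernel by blast
    fix \<bb> assume "\<bb> \<in> SEM \<Omega>"
    then obtain B where B: "has_stem \<bb> B" using SEM_iff by blast
    have inner_iff: "sem_inner \<Omega> (sem_inv \<Omega> h \<star> \<bb> \<star> sem_inv \<Omega> h') (\<lambda>q. \<J> q * J - K) \<simeq>\<^bsub>\<Omega>\<^esub> (\<lambda>_. 0)
        \<longleftrightarrow> (\<forall>\<^sub>\<approx>z\<in>D. bdot (X B z) (obstruction_vector J) = 0)"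
      using sem_eq_iff[OF has_stem_inner[OF has_stem_star[OF has_stem_star[OF has_stem_inv[OF h] B] has_stem_inv[OF h']] minus] zero]
      by (simp add: X_def biquat_eq_iff)
    show "(\<exists>\<phi>\<in>SEM \<Omega>. sylvester f g \<phi> \<simeq>\<^bsub>\<Omega>\<^esub> \<bb>) \<longleftrightarrow>
          sem_inner \<Omega> (sem_inv \<Omega> h \<star> \<bb> \<star> sem_inv \<Omega> h') (\<lambda>q. \<J> q * J - K) \<simeq>\<^bsub>\<Omega>\<^esub> (\<lambda>_. 0)"
      unfolding inner_iff
    proof
      assume "\<exists>\<phi>\<in>SEM \<Omega>. sylvester f g \<phi> \<simeq>\<^bsub>\<Omega>\<^esub> \<bb>"
      then obtain \<phi> C where C: "has_stem \<phi> C" and eq: "sylvester f g \<phi> \<simeq>\<^bsub>\<Omega>\<^esub> \<bb>"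
        using SEM_iff by blast
      have "\<forall>\<^sub>\<approx>z\<in>D. F z * C z + C z * G z = B z"
        using eq sem_eq_iff[OF syl[OF C] B] by blast
      then show "\<forall>\<^sub>\<approx>z\<in>D. bdot (X B z) (obstruction_vector J) = 0"
        using normal[of C] \<tau>ne
      proof eventually_elim
        case (elim z)
        then have "X B z = N (t z) (X C z)" by (simp add: X_def)
        then show ?case
          using normal_form_image(1)[OF J, of "t z" "X C z"] elim(3) by (simp add: N_def)
      qed
    next
      assume orth: "\<forall>\<^sub>\<approx>z\<in>D. bdot (X B z) (obstruction_vector J) = 0"
      define C where "C z = H z * bsolve (t z) (X B z) * H' z" for z
      have C: "has_stem (lift C) C"
        unfolding C_def by (intro has_stem_lift bq_meromorphic_intros bsolve_meromorphic Hm H'm tm Xm[OF B])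
      have "\<forall>\<^sub>\<approx>z\<in>D. F z * C z + C z * G z = B z"
        using orth normal[of C] sandwich \<tau>ne
      proof eventually_elim
        case (elim z)
        have "X C z = bsolve (t z) (X B z)"
          using elim(3) unfolding X_def C_def by blast
        then have "N (t z) (X C z) = X B z"
          using normal_form_image(2)[OF J, of "t z" "X B z"] elim(1,4) by (simp add: N_def)
        then have "binv (H z) * (F z * C z + C z * G z) * binv (H' z) = X B z" using elim(2) by simp
        then have "F z * C z + C z * G z = H z * X B z * H' z" using elim(3) by blast
        also have "\<dots> = B z" using elim(3) unfolding X_def by metis
        finally show ?case .
      qed
      then have "sylvester f g (lift C) \<simeq>\<^bsub>\<Omega>\<^esub> \<bb>"
        using sem_eq_iff[OF syl[OF C] B] by blast
      then show "\<exists>\<phi>\<in>SEM \<Omega>. sylvester f g \<phi> \<simeq>\<^bsub>\<Omega>\<^esub> \<bb>"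
        using has_stem_in_SEM[OF C] by blast
    qed
  qed
  ultimately show ?thesis
    using inv \<tau>R
    by (intro exI[of _ h] exI[of _ h'] exI[of _ \<tau>] exI[of _ qi] conjI ballI allI impI) auto
qed

end
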